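(* Let $\Phi\in\mathrm{End}(\mathcal{Q})$ and $n\ge0$. Suppose that for every $m\le n$ with $\lambda_m\neq0$ we have $\lambda_m\neq\lambda_\beta$ for all $\beta\in\operatorname{Comp}(m)\setminus\{(m)\}$, and suppose that $\operatorname{rank}(\Phi_n)=\#\{\alpha\in\operatorname{Comp}(n):\lambda_\alpha\neq0\}$. Then $\Phi_n$ is diagonalizable, and so is the operator $W\mapsto (X^\Phi)_n\cdot W$ on $\mathcal{D}_n$.
   Context: Work over $\mathbb{Q}$. Compositions $\alpha=(a_1,\dots,a_k)$ of $n$, $\operatorname{Comp}(n)$, $S_\alpha=\{a_1,\dots,a_1+\dots+a_{k-1}\}$, $\operatorname{co}=$ inverse of $\alpha\mapsto S_\alpha$, order $\alpha\le\beta$ iff $S_\alpha\subseteq S_\beta$. $M_\alpha=\sum_{i_1<\dots<i_k}x_{i_1}^{a_1}\cdots x_{i_k}^{a_k}$, $\mathcal{Q}_n=\operatorname{span}\{M_\alpha:\alpha\in\operatorname{Comp}(n)\}$, $\mathcal{Q}=\bigoplus_n\mathcal{Q}_n$ the graded Hopf algebra of quasisymmetric functions (coproduct $\Delta(M_\alpha)=\sum_{\alpha=\beta\cdot\gamma}M_\beta\otimes M_\gamma$), $F_\alpha=\sum_{\beta\ge\alpha}M_\beta$. $\mathrm{End}(\mathcal{Q})$ = graded Hopf algebra endomorphisms; $\Phi_n=\Phi|_{\mathcal{Q}_n}$. For $\sigma\in\mathfrak{S}_n$, $D(\sigma)=\operatorname{co}(\{i:\sigma_i>\sigma_{i+1}\})$.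 In $\mathbb{Q}[\mathfrak{S}_n]$ let $Y_\alpha=\sum_{D(\sigma)=\alpha}\sigma$, $X_\alpha=\sum_{D(\sigma)\le\alpha}\sigma$; their span $\mathcal{D}_n$ is a subalgebra (descent algebra). Pairing $\mathcal{D}_n\times\mathcal{Q}_n\to\mathbb{Q}$: $\langle X_\alpha,M_\beta\rangle=\delta_{\alpha\beta}$ (equivalently $\langle Y_\alpha,F_\beta\rangle=\delta_{\alpha\beta}$). For $\Phi\in\mathrm{End}(\mathcal{Q})$, $(X^\Phi)_n\in\mathcal{D}_n$ is defined by $\langle (X^\Phi)_n,G\rangle=\langle X_{(n)},\Phi(G)\rangle$ for $G\in\mathcal{Q}_n$ (here $X_{(n)}$ is the identity permutation; equivalently $\langle (X^\Phi)_n,G\rangle=\Phi(G)(1,0,0,\dots)$). Set $\lambda_m=\langle (X^\Phi)_m,M_{(m)}\rangle$ and $\lambda_\alpha=\lambda_{a_1}\cdots\lambda_{a_k}$ for $\alpha=(a_1,\dots,a_k)$. *)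

theory Defs
  imports
    Complex_Main
    "HOL-Library.Function_Algebras"
    "HOL-Library.Poly_Mapping"
    "HOL-Combinatorics.Permutations"
begin

section \<open>Rational vector spaces of functions\<close>

text \<open>Power series, power series in two alphabets, and elements of a group algebra are all
  represented by their coefficient functions \<^typ>\<open>'x \<Rightarrow> rat\<close>; addition is pointwise (from
  \<^theory>\<open>HOL-Library.Function_Algebras\<close>). The pointwise product of that theory is never used.\<close>

definition scale :: "rat \<Rightarrow> ('x \<Rightarrow> rat) \<Rightarrow> 'x \<Rightarrow> rat" where
  "scale c f = (\<lambda>x. c * f x)"

global_interpretation rvs: vector_space "scale :: rat \<Rightarrow> ('x \<Rightarrow> rat) \<Rightarrow> 'x \<Rightarrow> rat"
  by unfold_locales (auto simp: scale_def fun_eq_iff algebra_simps)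

definition diagonalizable_on :: "('x \<Rightarrow> rat) set \<Rightarrow> (('x \<Rightarrow> rat) \<Rightarrow> ('x \<Rightarrow> rat)) \<Rightarrow> bool" where
  "diagonalizable_on V T \<longleftrightarrow> T ` V \<subseteq> V \<and>
     (\<exists>B. B \<subseteq> V \<and> rvs.independent B \<and> rvs.span B = V \<and> (\<forall>b\<in>B. \<exists>c. T b = scale c b))"


section \<open>Compositions\<close>

definition compositions :: "nat list set" where
  "compositions = {\<alpha>. 0 \<notin> set \<alpha>}"

definition Comp :: "nat \<Rightarrow> nat list set" where
  "Comp n = {\<alpha> \<in> compositions. sum_list \<alpha> = n}"

definition psums :: "nat list \<Rightarrow> nat set" where
  "psums \<alpha> = {sum_list (take j \<alpha>) |j. 1 \<le> j \<and> j < length \<alpha>}"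

definition co :: "nat \<Rightarrow> nat set \<Rightarrow> nat list" where
  "co n = inv_into (Comp n) psums"

definition comp_le :: "nat list \<Rightarrow> nat list \<Rightarrow> bool" where
  "comp_le \<alpha> \<beta> \<longleftrightarrow> psums \<alpha> \<subseteq> psums \<beta>"

text \<open>The composition \<open>(n)\<close>; for \<open>n = 0\<close> this is the empty composition, the only element of
  \<open>Comp 0\<close>.\<close>

definition one_part :: "nat \<Rightarrow> nat list" where
  "one_part n = (if n = 0 then [] else [n])"


section \<open>Quasisymmetric functions\<close>

text \<open>A power series in \<open>x\<^sub>0, x\<^sub>1, x\<^sub>2, \<dots>\<close> maps each monomial (a finitely supported exponent
  vector) to its coefficient.\<close>

type_synonym monomial = "nat \<Rightarrow>\<^sub>0 nat"
type_synonym pseries = "monomial \<Rightarrow> rat"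
type_synonym pseries2 = "monomial \<times> monomial \<Rightarrow> rat"

definition ps_one :: pseries where
  "ps_one = (\<lambda>m. if m = 0 then 1 else 0)"

definition ps_mult :: "pseries \<Rightarrow> pseries \<Rightarrow> pseries" where
  "ps_mult f g = (\<lambda>m. \<Sum>(u, v) \<in> {(u, v). u + v = m}. f u * g v)"

definition xmono :: "nat list \<Rightarrow> nat list \<Rightarrow> monomial" where
  "xmono is \<alpha> = (\<Sum>j<length \<alpha>. Poly_Mapping.single (is ! j) (\<alpha> ! j))"

text \<open>The coefficient of \<open>m\<close> in the sum of \<open>x\<^bsub>i\<^sub>1\<^esub>\<^bsup>a\<^sub>1\<^esup> \<dots> x\<^bsub>i\<^sub>k\<^esub>\<^bsup>a\<^sub>k\<^esup>\<close> over \<open>i\<^sub>1 < \<dots> < i\<^sub>k\<close> is the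
  number of index sequences whose monomial is \<open>m\<close>.\<close>

definition M :: "nat list \<Rightarrow> pseries" where
  "M \<alpha> = (\<lambda>m. of_nat (card {is. sorted_wrt (<) is \<and> length is = length \<alpha> \<and> xmono is \<alpha> = m}))"

definition QSym_deg :: "nat \<Rightarrow> pseries set" where
  "QSym_deg n = rvs.span (M ` Comp n)"

definition QSym :: "pseries set" where
  "QSym = rvs.span (\<Union>n. QSym_deg n)"

definition M_coeff :: "pseries \<Rightarrow> nat list \<Rightarrow> rat" where
  "M_coeff f \<alpha> = rvs.representation (M ` compositions) f (M \<alpha>)"

text \<open>The tensor square of \<open>QSym\<close> is realised inside the power series in two alphabets, as the
  span of the products \<open>f(x) g(y)\<close>.\<close>

definition tensor :: "pseries \<Rightarrow> pseries \<Rightarrow> pseries2" where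
  "tensor f g = (\<lambda>(u, v). f u * g v)"

definition M_coeff2 :: "pseries2 \<Rightarrow> nat list \<times> nat list \<Rightarrow> rat" where
  "M_coeff2 t = (\<lambda>(\<beta>, \<gamma>).
     rvs.representation {tensor (M \<beta>) (M \<gamma>) |\<beta> \<gamma>. \<beta> \<in> compositions \<and> \<gamma> \<in> compositions}
       t (tensor (M \<beta>) (M \<gamma>)))"

text \<open>The linear map with \<open>M \<beta> \<otimes> M \<gamma> \<mapsto> \<Phi> (M \<beta>) \<otimes> \<Phi> (M \<gamma>)\<close>, i.e. \<open>\<Phi> \<otimes> \<Phi>\<close> for linear \<open>\<Phi>\<close>.\<close>

definition tensor_map :: "(pseries \<Rightarrow> pseries) \<Rightarrow> pseries2 \<Rightarrow> pseries2" where
  "tensor_map \<Phi> t =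
     (\<Sum>(\<beta>, \<gamma>) \<in> {(\<beta>, \<gamma>). \<beta> \<in> compositions \<and> \<gamma> \<in> compositions \<and> M_coeff2 t (\<beta>, \<gamma>) \<noteq> 0}.
        scale (M_coeff2 t (\<beta>, \<gamma>)) (tensor (\<Phi> (M \<beta>)) (\<Phi> (M \<gamma>))))"

definition coproduct :: "pseries \<Rightarrow> pseries2" where
  "coproduct f =
     (\<Sum>\<alpha> \<in> {\<alpha> \<in> compositions. M_coeff f \<alpha> \<noteq> 0}.
        scale (M_coeff f \<alpha>) (\<Sum>(\<beta>, \<gamma>) \<in> {(\<beta>, \<gamma>). \<beta> @ \<gamma> = \<alpha>}. tensor (M \<beta>) (M \<gamma>)))"

definition counit :: "pseries \<Rightarrow> rat" where
  "counit f = f 0"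

text \<open>Only the values of \<open>\<Phi>\<close> on \<open>QSym\<close> matter. Compatibility with the antipode is automatic for
  bialgebra endomorphisms.\<close>

definition hopf_endo :: "(pseries \<Rightarrow> pseries) \<Rightarrow> bool" where
  "hopf_endo \<Phi> \<longleftrightarrow>
     (\<forall>f\<in>QSym. \<forall>g\<in>QSym. \<Phi> (f + g) = \<Phi> f + \<Phi> g) \<and>
     (\<forall>c. \<forall>f\<in>QSym. \<Phi> (scale c f) = scale c (\<Phi> f)) \<and>
     (\<forall>n. \<Phi> ` QSym_deg n \<subseteq> QSym_deg n) \<and>
     \<Phi> ps_one = ps_one \<and>
     (\<forall>f\<in>QSym. \<forall>g\<in>QSym. \<Phi> (ps_mult f g) = ps_mult (\<Phi> f) (\<Phi> g)) \<and>
     (\<forall>f\<in>QSym. counit (\<Phi> f) = counit f) \<and>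
     (\<forall>f\<in>QSym. coproduct (\<Phi> f) = tensor_map \<Phi> (coproduct f))"


section \<open>The descent algebra\<close>

text \<open>Elements of the group algebra of the symmetric group on \<open>{1..n}\<close> are functions vanishing
  outside \<open>{\<sigma>. \<sigma> permutes {1..n}}\<close>.\<close>

type_synonym galg = "(nat \<Rightarrow> nat) \<Rightarrow> rat"

definition galg_mult :: "nat \<Rightarrow> galg \<Rightarrow> galg \<Rightarrow> galg" where
  "galg_mult n V W = (\<lambda>\<rho>.
     \<Sum>(\<sigma>, \<tau>) \<in> {(\<sigma>, \<tau>). \<sigma> permutes {1..n} \<and> \<tau> permutes {1..n} \<and> \<sigma> \<circ> \<tau> = \<rho>}. V \<sigma> * W \<tau>)"

definition D :: "nat \<Rightarrow> (nat \<Rightarrow> nat) \<Rightarrow> nat list" where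
  "D n \<sigma> = co n {i \<in> {1..<n}. \<sigma> i > \<sigma> (i + 1)}"

definition X :: "nat \<Rightarrow> nat list \<Rightarrow> galg" where
  "X n \<alpha> = (\<lambda>\<sigma>. if \<sigma> permutes {1..n} \<and> comp_le (D n \<sigma>) \<alpha> then 1 else 0)"

definition descent_algebra :: "nat \<Rightarrow> galg set" where
  "descent_algebra n = rvs.span (X n ` Comp n)"

definition X_coeff :: "nat \<Rightarrow> galg \<Rightarrow> nat list \<Rightarrow> rat" where
  "X_coeff n W \<alpha> = rvs.representation (X n ` Comp n) W (X n \<alpha>)"

definition pairing :: "nat \<Rightarrow> galg \<Rightarrow> pseries \<Rightarrow> rat" where
  "pairing n W G = (\<Sum>\<alpha>\<in>Comp n. X_coeff n W \<alpha> * M_coeff G \<alpha>)"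

definition X_of :: "(pseries \<Rightarrow> pseries) \<Rightarrow> nat \<Rightarrow> galg" where
  "X_of \<Phi> n = (THE W. W \<in> descent_algebra n \<and>
     (\<forall>G\<in>QSym_deg n. pairing n W G = pairing n (X n (one_part n)) (\<Phi> G)))"

definition eig :: "(pseries \<Rightarrow> pseries) \<Rightarrow> nat \<Rightarrow> rat" where
  "eig \<Phi> m = pairing m (X_of \<Phi> m) (M (one_part m))"

definition eig_comp :: "(pseries \<Rightarrow> pseries) \<Rightarrow> nat list \<Rightarrow> rat" where
  "eig_comp \<Phi> \<alpha> = prod_list (map (eig \<Phi>) \<alpha>)"

end

(*
  Comultiplicativity makes the matrix of \<Phi> in the basis M_\<alpha> triangular with diagonal entries
  \<lambda>_\<alpha>, and makes its transpose an endomorphism T of the free algebra on the one-part compositions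
  under concatenation. Multiplicativity of \<Phi>, applied to products of fundamental quasisymmetric
  functions, shows that T in the basis X_\<alpha> is left multiplication by (X^\<Phi>)_n. If \<lambda>_m differs
  from all other diagonal entries in degree m, then T has an eigenvector with leading term (m);
  products of these are independent eigenvectors for all nonzero \<lambda>_\<alpha>, and the rank hypothesis makes
  the kernel of T large enough to complete them to an eigenbasis. The dual basis diagonalizes \<Phi>.
*)

theory Submission
  imports
    Defs
    "HOL-Library.Product_Lexorder"
begin

section \<open>Diagonalizable matrices and their transposes\<close>

text \<open>The values \<lambda>_\<alpha> repeat: reordering the parts of \<alpha> does not change
  them. So the eigenvector equation of T with leading term \<alpha> has no evident solution for
  general \<alpha>, and distinct eigenvalues cannot give independence. Hence only the leading terms
  (m) are solved for, and independence is read off leading terms, ordered by the number of parts. A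
  nonzero \<lambda>_\<alpha> has only nonzero factors \<lambda>_a with a \<le> n, so the separation
  hypothesis reaches each part. For \<lambda>_\<alpha> = 0 it says nothing, and only the dimension
  of the kernel can help.

  The value of X_\<beta> X_\<alpha> at a permutation \<rho> is the coefficient of M_\<beta> in the
  product of the fundamental functions of the pieces into which \<alpha> cuts the word of \<rho>.
  Summing against the coordinates of (X^\<Phi>)_n therefore evaluates \<Phi> of that product at
  (1,0,0,...). This evaluation factors over the pieces, and comultiplicativity reassembles the
  factors into a column of T.\<close>

lemma sum_fun_apply: "(\<Sum>i\<in>A. f i) x = (\<Sum>i\<in>A. f i x)" for f :: "'i \<Rightarrow> 'x \<Rightarrow> rat"
  by (induction A rule: infinite_finite_induct) auto

lemma scale_apply [simp]: "scale c f x = c * f x"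
  by (simp add: scale_def)

text \<open>Independence is a property of sets, so an indexed family also has to be injective. The
  same hypothesis yields this: a repetition would be the relation
  \<open>e i - e j = 0\<close>.\<close>

lemma family_independentI:
  fixes e :: "'i \<Rightarrow> 'x \<Rightarrow> rat"
  assumes zero: "\<And>t u j. finite t \<Longrightarrow> t \<subseteq> J \<Longrightarrow> (\<Sum>i\<in>t. scale (u i) (e i)) = 0 \<Longrightarrow> j \<in> t \<Longrightarrow> u j = 0"
  shows "inj_on e J" and "rvs.independent (e ` J)"
proof -
  show inj: "inj_on e J"
  proof (rule inj_onI, rule ccontr)
    fix i j assume ij: "i \<in> J" "j \<in> J" "e i = e j" "i \<noteq> j"
    have "(\<Sum>k\<in>{i,j}. scale ((\<lambda>k. if k = i then 1 else -1) k) (e k)) = 0"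
      using ij by (auto simp: fun_eq_iff)
    from zero[OF _ _ this, of i] ij show False by auto
  qed
  show "rvs.independent (e ` J)"
    unfolding rvs.independent_explicit_module
  proof (intro allI impI)
    fix t u v assume t: "finite t" "t \<subseteq> e ` J" and s: "(\<Sum>v\<in>t. scale (u v) v) = 0" and v: "v \<in> t"
    from t obtain s where s': "s \<subseteq> J" "inj_on e s" "t = e ` s" using subset_image_inj by metis
    have "(\<Sum>i\<in>s. scale (u (e i)) (e i)) = 0" using s s' by (simp add: sum.reindex)
    moreover have "finite s" using s' t(1) finite_image_iff[OF s'(2)] by simp
    moreover obtain i where "i \<in> s" "v = e i" using v s' by auto
    ultimately show "u v = 0" using zero[of s "u \<circ> e" i] s' by (auto simp: o_def)
  qed
qed

text \<open>Among the terms with nonzero coefficient in a vanishing combination, one of maximal rank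
  is the only one that does not vanish at its test point \<open>p i\<close>. A constant rank
  expresses the diagonal case, since then \<open>e j (p i)\<close> must be 0 for all other j. Ranks
  are integers so that a negated length can serve as one.\<close>

lemma triangular_independent:
  fixes e :: "'i \<Rightarrow> 'x \<Rightarrow> rat" and r :: "'i \<Rightarrow> int"
  assumes diag: "\<And>i. i \<in> J \<Longrightarrow> e i (p i) \<noteq> 0"
    and tri: "\<And>i j. i \<in> J \<Longrightarrow> j \<in> J \<Longrightarrow> i \<noteq> j \<Longrightarrow> e j (p i) \<noteq> 0 \<Longrightarrow> r j > r i"
  shows "inj_on e J" and "rvs.independent (e ` J)"
proof -
  have *: "u j = 0" if t: "finite t" "t \<subseteq> J" and s: "(\<Sum>i\<in>t. scale (u i) (e i)) = 0" and j: "j \<in> t" for t u j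
  proof (rule ccontr)
    assume "u j \<noteq> 0"
    define A where "A = {i\<in>t. u i \<noteq> 0}"
    have A: "finite A" "A \<noteq> {}" using t j \<open>u j \<noteq> 0\<close> by (auto simp: A_def)
    have "Max (r ` A) \<in> r ` A" using A by (intro Max_in) auto
    then obtain i where iA: "i \<in> A" and Max: "Max (r ` A) = r i" by (rule imageE)
    have i: "i \<in> A" "\<And>k. k \<in> A \<Longrightarrow> r k \<le> r i"
      using iA A Max_ge[of "r ` A"] by (auto simp: Max[symmetric])
    have "0 = (\<Sum>k\<in>t. scale (u k) (e k)) (p i)" using s by simp
    also have "\<dots> = (\<Sum>k\<in>t. u k * e k (p i))" by (simp add: sum_fun_apply)
    also have "\<dots> = (\<Sum>k\<in>{i}. u k * e k (p i))"
    proof (rule sum.mono_neutral_right)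
      show "\<forall>k\<in>t - {i}. u k * e k (p i) = 0"
        using tri[of i] i t by (force simp: A_def)
    qed (use t i in \<open>auto simp: A_def\<close>)
    also have "\<dots> \<noteq> 0" using diag i t by (auto simp: A_def)
    finally show False by simp
  qed
  show "inj_on e J" by (rule family_independentI(1)) (rule *)
  show "rvs.independent (e ` J)" by (rule family_independentI(2)) (rule *)
qed

section \<open>Coordinate spaces, dual bases and transposed matrices\<close>

definition coords :: "'i set \<Rightarrow> ('i \<Rightarrow> rat) set" where
  "coords I = {c. \<forall>i. i \<notin> I \<longrightarrow> c i = 0}"

definition dot :: "'i set \<Rightarrow> ('i \<Rightarrow> rat) \<Rightarrow> ('i \<Rightarrow> rat) \<Rightarrow> rat" where
  "dot I a b = (\<Sum>i\<in>I. a i * b i)"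

definition unitv :: "'i \<Rightarrow> 'i \<Rightarrow> rat" where
  "unitv i = (\<lambda>j. if j = i then 1 else 0)"

definition mat_op :: "'i set \<Rightarrow> ('i \<Rightarrow> 'i \<Rightarrow> rat) \<Rightarrow> ('i \<Rightarrow> rat) \<Rightarrow> 'i \<Rightarrow> rat" where
  "mat_op I A c = (\<lambda>j. if j \<in> I then \<Sum>i\<in>I. A j i * c i else 0)"

lemma coords_subspace: "rvs.subspace (coords I)"
  by (auto simp: rvs.subspace_def coords_def)

lemma unitv_in_coords: "i \<in> I \<Longrightarrow> unitv i \<in> coords I"
  by (auto simp: coords_def unitv_def)

lemma coords_expand: "finite I \<Longrightarrow> c \<in> coords I \<Longrightarrow> (\<Sum>i\<in>I. scale (c i) (unitv i)) = c"
  by (auto simp: fun_eq_iff sum_fun_apply unitv_def coords_def if_distrib cong: if_cong)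

lemma coords_basis:
  assumes "finite I"
  shows "inj_on unitv I" "rvs.independent (unitv ` I)" "rvs.span (unitv ` I) = coords I"
proof -
  show "inj_on unitv I"
    by (rule triangular_independent[where p = "\<lambda>i. i" and r = "\<lambda>_. 0"]) (auto simp: unitv_def split: if_splits)
  show "rvs.independent (unitv ` I)"
    by (rule triangular_independent[where p = "\<lambda>i. i" and r = "\<lambda>_. 0"]) (auto simp: unitv_def split: if_splits)
  show "rvs.span (unitv ` I) = coords I"
  proof
    show "rvs.span (unitv ` I) \<subseteq> coords I"
      by (rule rvs.span_minimal) (auto simp: coords_subspace unitv_in_coords)
    show "coords I \<subseteq> rvs.span (unitv ` I)"
    proof
      fix c :: "'a \<Rightarrow> rat" assume "c \<in> coords I"
      with assms have "c = (\<Sum>i\<in>I. scale (c i) (unitv i))" by (simp add: coords_expand)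
      also have "\<dots> \<in> rvs.span (unitv ` I)"
        by (intro rvs.span_sum rvs.span_scale rvs.span_base) auto
      finally show "c \<in> rvs.span (unitv ` I)" .
    qed
  qed
qed

lemma basis_card: 
  assumes "finite I" "rvs.independent B" "rvs.span B = coords I"
  shows "finite B" "card B = card I"
proof -
  have "B \<subseteq> rvs.span (unitv ` I)" using assms coords_basis(3) rvs.span_superset by metis
  then show "finite B"
    using rvs.independent_span_bound[of "unitv ` I" B] assms by auto
  show "card B = card I"
    using rvs.dim_eq_card[of B "coords I"] rvs.dim_eq_card[of "unitv ` I" "coords I"] assms coords_basis[OF assms(1)]
    by (metis card_image rvs.span_span)
qed

lemma independent_full_span:
  assumes "finite I" "B \<subseteq> coords I" "rvs.independent B" "card B = card I"
  shows "rvs.span B = coords I"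
proof -
  obtain C where C: "B \<subseteq> C" "C \<subseteq> coords I" "rvs.independent C" "coords I \<subseteq> rvs.span C"
    using rvs.maximal_independent_subset_extend[OF assms(2,3)] by metis
  have "rvs.span C = coords I" using C rvs.span_minimal[OF C(2) coords_subspace] by auto
  from basis_card[OF assms(1) C(3) this] have "B = C" using C(1) assms(4) card_subset_eq by metis
  then show ?thesis using \<open>rvs.span C = coords I\<close> by simp
qed

lemma dot_unitv: "finite I \<Longrightarrow> i \<in> I \<Longrightarrow> dot I a (unitv i) = a i" "finite I \<Longrightarrow> i \<in> I \<Longrightarrow> dot I (unitv i) a = a i"
  by (auto simp: dot_def unitv_def if_distrib if_distribR cong: if_cong)

lemma dot_comm: "dot I a b = dot I b a"
  by (simp add: dot_def mult.commute)

lemma dot_sum_scale: "dot I (\<Sum>b\<in>B. scale (r b) (f b)) c = (\<Sum>b\<in>B. r b * dot I (f b) c)"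
  "dot I c (\<Sum>b\<in>B. scale (r b) (f b)) = (\<Sum>b\<in>B. r b * dot I c (f b))"
  by (simp_all add: dot_def sum_fun_apply sum_distrib_left sum_distrib_right mult_ac sum.swap[of _ B I])

lemma dot_eqI:
  assumes "finite I" "a \<in> coords I" "b \<in> coords I" "\<And>v. v \<in> coords I \<Longrightarrow> dot I v a = dot I v b"
  shows "a = b"
proof
  fix i show "a i = b i"
  proof (cases "i \<in> I")
    case True
    then show ?thesis using assms(4)[OF unitv_in_coords[OF True]] by (simp add: dot_unitv assms(1))
  qed (use assms(2,3) in \<open>auto simp: coords_def\<close>)
qed

lemma mat_op_in_coords: "mat_op I A c \<in> coords I"
  by (simp add: coords_def mat_op_def)

lemma dot_mat_op: 
  "dot I (mat_op I A a) b = dot I a (mat_op I (\<lambda>j i. A i j) b)"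
proof -
  have "dot I (mat_op I A a) b = (\<Sum>j\<in>I. \<Sum>i\<in>I. A j i * a i * b j)"
    by (simp add: dot_def mat_op_def sum_distrib_right)
  also have "\<dots> = (\<Sum>i\<in>I. \<Sum>j\<in>I. A j i * a i * b j)" by (rule sum.swap)
  also have "\<dots> = dot I a (mat_op I (\<lambda>j i. A i j) b)"
    by (simp add: dot_def mat_op_def sum_distrib_left mult_ac)
  finally show ?thesis .
qed

lemma mat_op_sum_scale: "mat_op I A (\<Sum>b\<in>B. scale (r b) (f b)) = (\<Sum>b\<in>B. scale (r b) (mat_op I A (f b)))"
  by (auto simp: fun_eq_iff mat_op_def sum_fun_apply sum_distrib_left sum_distrib_right mult_ac sum.swap[of _ B I])

lemma mat_op_add: "mat_op I A (a + b) = mat_op I A a + mat_op I A b"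
  by (auto simp: fun_eq_iff mat_op_def sum.distrib algebra_simps)

text \<open>The entries of \<open>d b\<close> are the b-coordinates of the unit vectors, so pairing
  with \<open>d b\<close> reads off the coefficient of b. Biorthogonality makes the new family
  independent, and its size makes it a basis.\<close>

lemma dual_basis_exists:
  assumes I: "finite I" and B: "rvs.independent B" "rvs.span B = coords I"
  obtains d where "\<And>b. b \<in> B \<Longrightarrow> d b \<in> coords I"
    "\<And>b b'. b \<in> B \<Longrightarrow> b' \<in> B \<Longrightarrow> dot I b (d b') = (if b = b' then 1 else 0)"
    "inj_on d B" "rvs.independent (d ` B)" "rvs.span (d ` B) = coords I"
proof -
  define d where "d b = (\<lambda>i. if i \<in> I then rvs.representation B (unitv i) b else 0)" for b
  have fin: "finite B" and card: "card B = card I" using basis_card[OF I B] by auto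
  have in_c: "d b \<in> coords I" for b by (auto simp: d_def coords_def)
  have sp: "unitv i \<in> rvs.span B" if "i \<in> I" for i using that B(2) unitv_in_coords by auto
  have dot: "dot I v (d b) = rvs.representation B v b" if v: "v \<in> coords I" for v b
  proof -
    have "rvs.representation B v b = rvs.representation B (\<Sum>i\<in>I. scale (v i) (unitv i)) b"
      using coords_expand[OF I v] by simp
    also have "\<dots> = (\<Sum>i\<in>I. v i * rvs.representation B (unitv i) b)"
      using sp by (simp add: rvs.representation_sum rvs.representation_scale B(1) rvs.span_scale)
    also have "\<dots> = dot I v (d b)" by (simp add: dot_def d_def)
    finally show ?thesis ..
  qed
  have BI: "b \<in> coords I" if "b \<in> B" for b using that B(2) rvs.span_base by blast
  have delta: "dot I b (d b') = (if b = b' then 1 else 0)" if "b \<in> B" "b' \<in> B" for b b'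
    using that by (simp add: dot BI rvs.representation_basis[OF B(1)])
  have z: "u b = 0" if "finite t" "t \<subseteq> B" "(\<Sum>i\<in>t. scale (u i) (d i)) = 0" "b \<in> t" for t u b
  proof -
    have "0 = dot I b (\<Sum>i\<in>t. scale (u i) (d i))" using that by (simp add: dot_def)
    also have "\<dots> = (\<Sum>i\<in>t. u i * (if b = i then 1 else 0))"
      unfolding dot_sum_scale
    proof (rule sum.cong[OF refl])
      fix x assume "x \<in> t"
      with that have "b \<in> B" "x \<in> B" by auto
      then show "u x * dot I b (d x) = u x * (if b = x then 1 else 0)" by (simp only: delta)
    qed
    also have "\<dots> = u b" using that by (simp add: if_distrib cong: if_cong)
    finally show ?thesis by simp
  qed
  have inj: "inj_on d B" by (rule family_independentI(1)) (rule z)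
  have ind: "rvs.independent (d ` B)" by (rule family_independentI(2)) (rule z)
  have "rvs.span (d ` B) = coords I"
    by (rule independent_full_span) (use I in_c ind card card_image[OF inj] in auto)
  with that[of d] in_c delta inj ind show ?thesis by blast
qed

lemma eigenbasis_diagonalizable:
  assumes "T ` V \<subseteq> V" "B \<subseteq> V" "rvs.independent B" "rvs.span B = V" "\<And>b. b \<in> B \<Longrightarrow> \<exists>c. T b = scale c b"
  shows "diagonalizable_on V T"
  using assms unfolding diagonalizable_on_def by blast

lemma diagonalizable_onE:
  assumes "diagonalizable_on V T"
  obtains B ev where "B \<subseteq> V" "rvs.independent B" "rvs.span B = V" "\<And>b. b \<in> B \<Longrightarrow> T b = scale (ev b) b"
proof -
  from assms obtain B where B: "B \<subseteq> V" "rvs.independent B" "rvs.span B = V" "\<forall>b\<in>B. \<exists>c. T b = scale c b"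
    unfolding diagonalizable_on_def by (elim conjE exE)
  from bchoice[OF B(4)] obtain ev where "\<forall>b\<in>B. T b = scale (ev b) b" by (rule exE)
  with B(1-3) that[of B ev] show ?thesis by blast
qed

text \<open>The transpose is the adjoint for \<open>dot\<close>, so the basis dual to an eigenbasis
  consists of eigenvectors of the transpose with the same eigenvalues. It suffices to test this
  against the eigenbasis.\<close>

lemma diagonalizable_transpose:
  assumes I: "finite I" and diag: "diagonalizable_on (coords I) (mat_op I A)"
  shows "diagonalizable_on (coords I) (mat_op I (\<lambda>j i. A i j))"
proof -
  let ?S = "mat_op I (\<lambda>j i. A i j)"
  obtain B ev where B: "rvs.independent B" "rvs.span B = coords I"
    and ev: "\<And>b. b \<in> B \<Longrightarrow> mat_op I A b = scale (ev b) b"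
    by (rule diagonalizable_onE[OF diag]) (rule that)
  obtain d where d: "\<And>b. b \<in> B \<Longrightarrow> d b \<in> coords I"
    "\<And>b b'. b \<in> B \<Longrightarrow> b' \<in> B \<Longrightarrow> dot I b (d b') = (if b = b' then 1 else 0)"
    "rvs.independent (d ` B)" "rvs.span (d ` B) = coords I"
    by (rule dual_basis_exists[OF I B(1,2)]) (rule that)
  have fin: "finite B" using basis_card[OF I B(1,2)] by auto
  have eig: "?S (d b) = scale (ev b) (d b)" if b: "b \<in> B" for b
  proof (rule dot_eqI[OF I])
    show "?S (d b) \<in> coords I" by (rule mat_op_in_coords)
    show "scale (ev b) (d b) \<in> coords I" using d(1)[OF b] coords_subspace rvs.subspace_scale by blast
    fix v assume "v \<in> coords I"
    then have "v \<in> rvs.span B" using B by simp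
    then have v: "v = (\<Sum>x\<in>B. scale (rvs.representation B v x) x)"
      using rvs.sum_representation_eq[OF B(1)] fin by auto
    define r where "r = rvs.representation B v"
    have v: "v = (\<Sum>x\<in>B. scale (r x) x)" using v r_def by simp
    have "dot I x (?S (d b)) = dot I x (scale (ev b) (d b))" if x: "x \<in> B" for x
    proof -
      have "dot I x (?S (d b)) = dot I (scale (ev x) x) (d b)" using dot_mat_op[of I A x "d b"] ev[OF x] by simp
      also have "\<dots> = ev x * dot I x (d b)" by (simp add: dot_def sum_distrib_left mult_ac)
      \<comment> \<open>The pairing vanishes unless x = b, so one eigenvalue may be exchanged for
        the other.\<close>
      also have "\<dots> = ev b * dot I x (d b)" using d(2)[OF x b] by simp
      also have "\<dots> = dot I x (scale (ev b) (d b))" by (simp add: dot_def sum_distrib_left mult_ac)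
      finally show ?thesis .
    qed
    then show "dot I v (?S (d b)) = dot I v (scale (ev b) (d b))"
      unfolding v dot_sum_scale by simp
  qed
  show ?thesis
    by (rule eigenbasis_diagonalizable[where B = "d ` B"]) (use d eig mat_op_in_coords in auto)
qed

text \<open>The annihilator of the image of the transpose is the kernel; together with the given
  eigenvectors for nonzero eigenvalues it exhausts the space by a dimension count.\<close>

lemma eigenvectors_rank_diagonalizable:
  assumes I: "finite I" and J: "J \<subseteq> I"
    and e: "\<And>j. j \<in> J \<Longrightarrow> e j \<in> coords I" "inj_on e J" "rvs.independent (e ` J)"
    and eig: "\<And>j. j \<in> J \<Longrightarrow> mat_op I A (e j) = scale (ev j) (e j)" "\<And>j. j \<in> J \<Longrightarrow> ev j \<noteq> 0"
    and rank: "rvs.dim (mat_op I (\<lambda>j i. A i j) ` coords I) = card J"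
  shows "diagonalizable_on (coords I) (mat_op I A)"
proof -
  let ?S = "mat_op I (\<lambda>j i. A i j)"
  have finJ: "finite J" using I J finite_subset by auto
  obtain U where U: "U \<subseteq> ?S ` coords I" "rvs.independent U" "?S ` coords I \<subseteq> rvs.span U" "card U = card J"
    using rvs.basis_exists[of "?S ` coords I"] rank by metis
  have "U \<subseteq> coords I" using U(1) mat_op_in_coords by blast
  then obtain C where C: "U \<subseteq> C" "C \<subseteq> coords I" "rvs.independent C" "coords I \<subseteq> rvs.span C"
    using rvs.maximal_independent_subset_extend U(2) by metis
  have spC: "rvs.span C = coords I" using C rvs.span_minimal[OF C(2) coords_subspace] by auto
  note Ccard = basis_card[OF I C(3) spC]
  obtain d where d: "\<And>b. b \<in> C \<Longrightarrow> d b \<in> coords I"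
    "\<And>b b'. b \<in> C \<Longrightarrow> b' \<in> C \<Longrightarrow> dot I b (d b') = (if b = b' then 1 else 0)"
    "inj_on d C" "rvs.independent (d ` C)"
    by (rule dual_basis_exists[OF I C(3) spC]) (rule that)
  \<comment> \<open>C extends a basis U of the image of the transpose. The dual vectors of
    \<open>C - U\<close> annihilate that image, hence lie in the kernel, and there are
    \<open>card I - card J\<close> of them.\<close>
  define K where "K = d ` (C - U)"
  have finU: "finite U" using C(1) Ccard(1) finite_subset by auto
  have cardK: "card K + card J = card I"
  proof -
    have "card K = card (C - U)" unfolding K_def
      by (rule card_image) (use d(3) in \<open>auto intro: inj_on_subset\<close>)
    also have "\<dots> = card C - card U" using C(1) finU by (rule card_Diff_subset[rotated])
    finally show ?thesis using U(4) Ccard card_mono[OF Ccard(1) C(1)] by simp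
  qed
  have indK: "rvs.independent K" by (rule rvs.independent_mono[OF d(4)]) (auto simp: K_def)
  have ker: "mat_op I A k = 0" if "k \<in> K" for k
  proof (rule dot_eqI[OF I mat_op_in_coords])
    show "0 \<in> coords I" by (simp add: coords_def)
    fix v assume v: "v \<in> coords I"
    obtain c where c: "c \<in> C" "c \<notin> U" "k = d c" using \<open>k \<in> K\<close> K_def by auto
    have "?S v \<in> rvs.span U" using U(3) v by auto
    then have "?S v = (\<Sum>x\<in>U. scale (rvs.representation U (?S v) x) x)"
      using rvs.sum_representation_eq[OF U(2)] finU by auto
    then have "dot I (?S v) k = dot I (\<Sum>x\<in>U. scale (rvs.representation U (?S v) x) x) k" by (rule arg_cong)
    also have "\<dots> = (\<Sum>x\<in>U. rvs.representation U (?S v) x * dot I x k)"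
      by (rule dot_sum_scale(1))
    also have "\<dots> = 0"
    proof (rule sum.neutral, rule ballI)
      fix x assume "x \<in> U"
      then have "dot I x (d c) = 0" using d(2)[of x c] c C(1) by auto
      then show "rvs.representation U (?S v) x * dot I x k = 0" using c by simp
    qed
    finally have "dot I (?S v) k = 0" .
    then show "dot I v (mat_op I A k) = dot I v 0"
      using dot_mat_op[of I A k v] by (simp add: dot_comm) (simp add: dot_def)
  qed
  have finK: "finite K" using Ccard K_def by auto
  have zero: "u b = 0" if t: "(\<Sum>b\<in>K \<union> e ` J. scale (u b) b) = 0" and dis: "K \<inter> e ` J = {}" and b: "b \<in> K \<union> e ` J" for u b
  proof -
    have split: "(\<Sum>b\<in>K. scale (u b) b) + (\<Sum>j\<in>J. scale (u (e j)) (e j)) = 0"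
      using t dis finK finJ e(2) by (simp add: sum.union_disjoint sum.reindex)
    \<comment> \<open>The matrix kills K and multiplies each \<open>e j\<close> by a nonzero scalar.
      Applying it to a relation therefore isolates the coefficients of the \<open>e j\<close>; once
      these vanish, independence of K finishes.\<close>
    have "mat_op I A ((\<Sum>b\<in>K. scale (u b) b) + (\<Sum>j\<in>J. scale (u (e j)) (e j))) = 0"
      unfolding split by (auto simp: mat_op_def fun_eq_iff)
    then have "(\<Sum>b\<in>K. scale (u b) (mat_op I A b)) + (\<Sum>j\<in>J. scale (u (e j)) (mat_op I A (e j))) = 0"
      by (simp add: mat_op_add mat_op_sum_scale)
    moreover have "(\<Sum>b\<in>K. scale (u b) (mat_op I A b)) = 0" using ker by simp
    moreover have "(\<Sum>j\<in>J. scale (u (e j)) (mat_op I A (e j))) = (\<Sum>j\<in>J. scale (u (e j) * ev j) (e j))"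
      using eig by (intro sum.cong) auto
    ultimately have "(\<Sum>j\<in>J. scale (u (e j) * ev j) (e j)) = 0" by simp
    then have "(\<Sum>x\<in>e ` J. scale (u x * ev (the_inv_into J e x)) x) = 0"
      using e(2) by (simp add: sum.reindex the_inv_into_f_f)
    then have "u (e j) * ev (the_inv_into J e (e j)) = 0" if "j \<in> J" for j
      using e(3)[unfolded rvs.independent_explicit_module, rule_format, of "e ` J" "\<lambda>x. u x * ev (the_inv_into J e x)" "e j"] finJ that by auto
    then have ue: "u (e j) = 0" if "j \<in> J" for j using that eig(2) e(2) by (simp add: the_inv_into_f_f)
    then have "(\<Sum>b\<in>K. scale (u b) b) = 0" using split by simp
    then have "u b = 0" if "b \<in> K" for b
      using indK[unfolded rvs.independent_explicit_module] finK that by blast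
    then show ?thesis using ue b by auto
  qed
  have dis: "K \<inter> e ` J = {}"
  proof (rule ccontr)
    assume "K \<inter> e ` J \<noteq> {}"
    then obtain j where j: "j \<in> J" "e j \<in> K" by auto
    then have "scale (ev j) (e j) = 0" using ker eig by metis
    then have "e j = 0" using eig(2)[OF j(1)] by (simp add: fun_eq_iff)
    then show False using e(3) j rvs.dependent_zero by (metis imageI)
  qed
  have ind: "rvs.independent (K \<union> e ` J)"
    by (rule rvs.independent_if_scalars_zero) (use finK finJ zero dis in auto)
  have sub: "K \<union> e ` J \<subseteq> coords I" using d(1) e(1) K_def by auto
  have cd: "card (K \<union> e ` J) = card I"
    using dis finK finJ cardK card_image[OF e(2)] by (simp add: card_Un_disjoint)
  have "rvs.span (K \<union> e ` J) = coords I" by (rule independent_full_span[OF I sub ind cd])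
  then show ?thesis
  proof (intro eigenbasis_diagonalizable[where B = "K \<union> e ` J"])
    show "\<exists>c. mat_op I A b = scale c b" if "b \<in> K \<union> e ` J" for b
      using that ker[of b] eig(1) by (auto intro: exI[of _ 0])
  qed (use sub ind mat_op_in_coords in auto)
qed

section \<open>Transport between coordinates and the span of a family\<close>

definition lin_comb :: "'i set \<Rightarrow> ('i \<Rightarrow> 'x \<Rightarrow> rat) \<Rightarrow> ('i \<Rightarrow> rat) \<Rightarrow> 'x \<Rightarrow> rat" where
  "lin_comb I v c = (\<Sum>i\<in>I. scale (c i) (v i))"

lemma lin_comb_linear: "Vector_Spaces.linear scale scale (lin_comb I v)"
  unfolding Vector_Spaces.linear_iff
  by (auto simp: lin_comb_def fun_eq_iff sum_fun_apply algebra_simps sum.distrib sum_distrib_left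
      intro: rvs.vector_space_axioms)

lemma lin_comb_image:
  assumes I: "finite I"
  shows "lin_comb I v ` coords I = rvs.span (v ` I)"
proof
  show "lin_comb I v ` coords I \<subseteq> rvs.span (v ` I)"
    unfolding lin_comb_def by (intro image_subsetI rvs.span_sum rvs.span_scale rvs.span_base) auto
  interpret L: Vector_Spaces.linear scale scale "lin_comb I v" by (rule lin_comb_linear)
  have "rvs.subspace (lin_comb I v ` coords I)" by (rule L.subspace_image[OF coords_subspace])
  moreover have "v i \<in> lin_comb I v ` coords I" if "i \<in> I" for i
  proof
    have "lin_comb I v (unitv i) = (\<Sum>j\<in>I. if j = i then v j else 0)"
      unfolding lin_comb_def by (intro sum.cong) (auto simp: unitv_def)
    then show "v i = lin_comb I v (unitv i)" using I that by simp
    show "unitv i \<in> coords I" using that by (rule unitv_in_coords)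
  qed
  ultimately show "rvs.span (v ` I) \<subseteq> lin_comb I v ` coords I" by (intro rvs.span_minimal) auto
qed

lemma lin_comb_inj:
  assumes I: "finite I" and v: "inj_on v I" "rvs.independent (v ` I)"
  shows "inj_on (lin_comb I v) (coords I)"
proof (rule inj_onI)
  fix a b assume ab: "a \<in> coords I" "b \<in> coords I" "lin_comb I v a = lin_comb I v b"
  have "(\<Sum>i\<in>I. scale (a i - b i) (v i)) = 0"
    using ab(3) by (simp add: lin_comb_def rvs.scale_left_diff_distrib sum_subtractf)
  then have "(\<Sum>x\<in>v ` I. scale (a (the_inv_into I v x) - b (the_inv_into I v x)) x) = 0"
    using v(1) by (simp add: sum.reindex the_inv_into_f_f)
  then have "a (the_inv_into I v (v i)) - b (the_inv_into I v (v i)) = 0" if "i \<in> I" for i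
    using v(2)[unfolded rvs.independent_explicit_module, rule_format, of "v ` I" "\<lambda>x. a (the_inv_into I v x) - b (the_inv_into I v x)" "v i"] I that by auto
  then have "a i = b i" if "i \<in> I" for i using that v(1) by (simp add: the_inv_into_f_f)
  moreover have "a i = b i" if "i \<notin> I" for i using ab(1,2) that by (simp add: coords_def)
  ultimately show "a = b" by blast
qed

text \<open>For an independent family \<open>lin_comb\<close> is an isomorphism onto the span, and
  it intertwines T with the matrix, so it carries an eigenbasis to an eigenbasis.\<close>

lemma diagonalizable_transport:
  assumes I: "finite I" and v: "inj_on v I" "rvs.independent (v ` I)"
    and T: "\<And>c. c \<in> coords I \<Longrightarrow> T (lin_comb I v c) = lin_comb I v (mat_op I A c)"
    and diag: "diagonalizable_on (coords I) (mat_op I A)"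
  shows "diagonalizable_on (rvs.span (v ` I)) T"
proof -
  interpret L: Vector_Spaces.linear scale scale "lin_comb I v" by (rule lin_comb_linear)
  obtain B ev where B: "B \<subseteq> coords I" "rvs.independent B" "rvs.span B = coords I"
    "\<And>b. b \<in> B \<Longrightarrow> mat_op I A b = scale (ev b) b"
    by (rule diagonalizable_onE[OF diag]) (rule that)
  show ?thesis
  proof (rule eigenbasis_diagonalizable[where B = "lin_comb I v ` B"])
    show "T ` rvs.span (v ` I) \<subseteq> rvs.span (v ` I)"
      unfolding lin_comb_image[OF I, symmetric]
      by (intro image_subsetI) (use T in \<open>auto intro!: imageI mat_op_in_coords\<close>)
    show "lin_comb I v ` B \<subseteq> rvs.span (v ` I)"
      unfolding lin_comb_image[OF I, symmetric] using B by auto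
    show "rvs.independent (lin_comb I v ` B)"
      by (rule L.independent_injective_image[OF B(2)]) (use lin_comb_inj[OF I v] B(3) in simp)
    show "rvs.span (lin_comb I v ` B) = rvs.span (v ` I)"
      unfolding L.span_image B(3) lin_comb_image[OF I] ..
    show "\<exists>c. T b = scale c b" if b: "b \<in> lin_comb I v ` B" for b
    proof -
      from b obtain b' where "b = lin_comb I v b'" "b' \<in> B" by (rule imageE)
      then have "T b = scale (ev b') b" using T[of b'] B(1,4) L.scale[of "ev b'" b'] by auto
      then show ?thesis ..
    qed
  qed
qed

text \<open>Turns the rank hypothesis on \<Phi> into one on its matrix.\<close>

lemma dim_transport:
  assumes I: "finite I" and v: "inj_on v I" "rvs.independent (v ` I)"
    and T: "\<And>c. c \<in> coords I \<Longrightarrow> T (lin_comb I v c) = lin_comb I v (mat_op I A c)"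
  shows "rvs.dim (T ` rvs.span (v ` I)) = rvs.dim (mat_op I A ` coords I)"
proof -
  interpret L: Vector_Spaces.linear scale scale "lin_comb I v" by (rule lin_comb_linear)
  obtain B where B: "B \<subseteq> mat_op I A ` coords I" "rvs.independent B" "mat_op I A ` coords I \<subseteq> rvs.span B"
    "card B = rvs.dim (mat_op I A ` coords I)"
    using rvs.basis_exists by metis
  have BI: "B \<subseteq> coords I" using B(1) mat_op_in_coords by blast
  have spB: "rvs.span B \<subseteq> coords I" by (rule rvs.span_minimal[OF BI coords_subspace])
  have inj: "inj_on (lin_comb I v) (rvs.span B)" using lin_comb_inj[OF I v] spB inj_on_subset by blast
  have im: "T ` rvs.span (v ` I) = lin_comb I v ` (mat_op I A ` coords I)"
    unfolding lin_comb_image[OF I, symmetric] using T by (auto simp: image_image)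
  have "rvs.dim (T ` rvs.span (v ` I)) = card (lin_comb I v ` B)"
  proof (rule rvs.dim_unique)
    show "lin_comb I v ` B \<subseteq> T ` rvs.span (v ` I)" unfolding im using B by blast
    show "T ` rvs.span (v ` I) \<subseteq> rvs.span (lin_comb I v ` B)" unfolding im L.span_image using B by blast
    show "rvs.independent (lin_comb I v ` B)" by (rule L.independent_injective_image[OF B(2) inj])
  qed simp
  also have "\<dots> = card B" by (rule card_image) (use inj rvs.span_superset inj_on_subset in blast)
  finally show ?thesis using B by simp
qed

section \<open>Compositions and block-sorted words\<close>

lemma Nil_in_Comp [simp]: "[] \<in> Comp n \<longleftrightarrow> n = 0"
  by (auto simp: Comp_def compositions_def)

lemma Cons_in_Comp: "a # \<alpha> \<in> Comp n \<longleftrightarrow> 0 < a \<and> a \<le> n \<and> \<alpha> \<in> Comp (n - a)"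
  by (auto simp: Comp_def compositions_def)

lemma append_in_Comp: "\<alpha> \<in> Comp m \<Longrightarrow> \<beta> \<in> Comp n \<Longrightarrow> \<alpha> @ \<beta> \<in> Comp (m + n)"
  by (auto simp: Comp_def compositions_def)

lemma one_part_in_Comp: "one_part n \<in> Comp n"
  by (auto simp: one_part_def Cons_in_Comp)

lemma Comp_0: "Comp 0 = {[]}"
  by (auto simp: Comp_def compositions_def) (metis list.set_intros(1) neq_Nil_conv)

lemma Comp_compositions: "\<alpha> \<in> Comp n \<Longrightarrow> \<alpha> \<in> compositions"
  by (simp add: Comp_def)

lemma length_Comp_le: "\<alpha> \<in> Comp n \<Longrightarrow> length \<alpha> \<le> n"
proof (induction \<alpha> arbitrary: n)
  case (Cons a \<alpha>)
  then show ?case by (force simp: Cons_in_Comp)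
qed simp

lemma finite_Comp: "finite (Comp n)"
proof (rule finite_subset)
  show "Comp n \<subseteq> {\<alpha>. set \<alpha> \<subseteq> {..n} \<and> length \<alpha> \<le> n}"
    using length_Comp_le member_le_sum_list by (fastforce simp: Comp_def)
  show "finite {\<alpha>. set \<alpha> \<subseteq> {..n} \<and> length \<alpha> \<le> n}" by (rule finite_lists_length_le) simp
qed

text \<open>Minimality of \<open>one_part n\<close> for length makes it the starting index when
  triangular systems are solved by increasing length.\<close>

lemma Comp_length_le_1:
  assumes "\<alpha> \<in> Comp n" "length \<alpha> \<le> length (one_part n)"
  shows "\<alpha> = one_part n"
proof (cases \<alpha>)
  case Nil
  then show ?thesis using assms by (simp add: one_part_def)
next
  case (Cons a \<beta>)
  with assms have "\<beta> = []" by (auto simp: one_part_def split: if_splits)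
  with Cons assms show ?thesis by (auto simp: one_part_def Cons_in_Comp)
qed

lemma psums_Nil [simp]: "psums [] = {}" and psums_single [simp]: "psums [a] = {}"
  by (auto simp: psums_def)

lemma psums_image: "psums \<alpha> = (\<lambda>j. sum_list (take j \<alpha>)) ` {1..<length \<alpha>}"
  by (auto simp: psums_def)

text \<open>The total is left out of \<open>psums\<close>. With an empty tail the first part would
  be that total, hence the hypothesis.\<close>

lemma psums_Cons: 
  assumes "\<alpha> \<noteq> []" shows "psums (a # \<alpha>) = insert a ((+) a ` psums \<alpha>)"
proof -
  have "psums (a # \<alpha>) = (\<lambda>j. sum_list (take j (a # \<alpha>))) ` {1..<Suc (length \<alpha>)}"
    by (simp add: psums_image)
  also have "{1..<Suc (length \<alpha>)} = insert 1 (Suc ` {1..<length \<alpha>})"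
    using assms by (subst image_Suc_atLeastLessThan) (auto simp: Suc_le_eq)
  also have "(\<lambda>j. sum_list (take j (a # \<alpha>))) ` \<dots> = insert a ((\<lambda>j. a + sum_list (take j \<alpha>)) ` {1..<length \<alpha>})"
    by (simp only: image_insert image_image take_Suc_Cons sum_list.Cons One_nat_def take_0 sum_list.Nil add_0_right)
  also have "(\<lambda>j. a + sum_list (take j \<alpha>)) ` {1..<length \<alpha>} = (+) a ` psums \<alpha>"
    by (simp add: psums_image image_image)
  finally show ?thesis .
qed

lemma psums_subset: "\<alpha> \<in> Comp n \<Longrightarrow> psums \<alpha> \<subseteq> {1..<n}"
proof (induction \<alpha> arbitrary: n)
  case (Cons a \<alpha>)
  show ?case
  proof (cases "\<alpha> = []")
    case False
    then have "0 < n - a" using Cons.prems by (cases \<alpha>) (auto simp: Cons_in_Comp)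
    then show ?thesis using Cons.IH[of "n - a"] Cons.prems psums_Cons[OF False, of a]
      by (auto simp: Cons_in_Comp subset_iff)
  qed simp
qed simp

lemma psums_inj: "\<alpha> \<in> Comp n \<Longrightarrow> \<beta> \<in> Comp n \<Longrightarrow> psums \<alpha> = psums \<beta> \<Longrightarrow> \<alpha> = \<beta>"
proof (induction \<alpha> arbitrary: n \<beta>)
  case Nil
  then show ?case using Comp_0 by auto
next
  case (Cons a \<alpha>)
  then obtain b \<gamma> where \<beta>: "\<beta> = b # \<gamma>" by (cases \<beta>) (auto simp: Cons_in_Comp)
  \<comment> \<open>With at least two parts, the first part is the least partial sum and can be
    recovered from the set.\<close>
  have min: "Min (psums (c # \<delta>)) = c" if "\<delta> \<noteq> []" "c # \<delta> \<in> Comp n" for c \<delta>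
  proof -
    have "finite (psums \<delta>)" using psums_subset[of \<delta> "n - c"] that by (auto simp: Cons_in_Comp intro: finite_subset)
    then show ?thesis unfolding psums_Cons[OF that(1)] by (intro Min_eqI) auto
  qed
  show ?case
  proof (cases "\<alpha> = [] \<or> \<gamma> = []")
    case True
    then have "psums (a # \<alpha>) = {}" using Cons.prems \<beta> by auto
    then have "\<alpha> = []" "\<gamma> = []" using Cons.prems \<beta> psums_Cons by fastforce+
    then show ?thesis using Cons.prems \<beta> by (auto simp: Cons_in_Comp)
  next
    case False
    then have ab: "a = b" using min[of \<alpha> a] min[of \<gamma> b] Cons.prems \<beta> by auto
    have nz: "0 \<notin> psums \<alpha>" "0 \<notin> psums \<gamma>"
      using psums_subset[of \<alpha> "n - a"] psums_subset[of \<gamma> "n - b"] Cons.prems \<beta> by (auto simp: Cons_in_Comp)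
    have "insert a ((+) a ` psums \<alpha>) = insert a ((+) a ` psums \<gamma>)"
      using Cons.prems(3) False unfolding \<beta> ab by (simp add: psums_Cons)
    moreover have "a \<notin> (+) a ` psums \<alpha>" "a \<notin> (+) a ` psums \<gamma>" using nz by auto
    ultimately have "(+) a ` psums \<alpha> = (+) a ` psums \<gamma>" by (metis insert_ident)
    then have "psums \<alpha> = psums \<gamma>" by (simp add: inj_image_eq_iff)
    then show ?thesis using Cons.IH[of "n - a" \<gamma>] Cons.prems \<beta> ab by (auto simp: Cons_in_Comp)
  qed
qed

text \<open>The least element of S becomes the first part; the others, shifted down by it, are
  covered by the induction hypothesis.\<close>

lemma psums_surj: "S \<subseteq> {1..<n} \<Longrightarrow> \<exists>\<alpha>\<in>Comp n. psums \<alpha> = S"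
proof (induction n arbitrary: S rule: less_induct)
  case (less n)
  show ?case
  proof (cases "S = {}")
    case True
    then show ?thesis using one_part_in_Comp[of n] by (intro bexI[of _ "one_part n"]) (auto simp: one_part_def)
  next
    case False
    have fin: "finite S" using less.prems finite_subset by blast
    define a where "a = Min S"
    have a: "a \<in> S" "\<And>x. x \<in> S \<Longrightarrow> a \<le> x" using fin False by (auto simp: a_def)
    have a': "0 < a" "a < n" using a(1) less.prems by auto
    define S' where "S' = (\<lambda>x. x - a) ` (S - {a})"
    have "S' \<subseteq> {1..<n - a}" using less.prems a(2) by (force simp: S'_def)
    then obtain \<alpha> where \<alpha>: "\<alpha> \<in> Comp (n - a)" "psums \<alpha> = S'" using less.IH[of "n - a" S'] a' by auto
    have "\<alpha> \<noteq> []" using \<alpha> a' by auto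
    have "(+) a ` S' = S - {a}" using a(2) by (force simp: S'_def image_image)
    then have "psums (a # \<alpha>) = S" using psums_Cons[OF \<open>\<alpha> \<noteq> []\<close>, of a] \<alpha> a(1) by auto
    moreover have "a # \<alpha> \<in> Comp n" using \<alpha> a' by (auto simp: Cons_in_Comp)
    ultimately show ?thesis by blast
  qed
qed

lemma psums_co: "S \<subseteq> {1..<n} \<Longrightarrow> psums (co n S) = S"
  unfolding co_def using psums_surj[of S n] by (metis f_inv_into_f image_eqI)

text \<open>For a permutation word and \<open><\<close> this says that the descents lie in
  \<open>psums \<alpha>\<close>. The recursive form is chosen because it splits along concatenation
  of compositions and applies to words of pairs as well as to words of numbers.\<close>

fun block_sorted :: "('a \<Rightarrow> 'a \<Rightarrow> bool) \<Rightarrow> 'a list \<Rightarrow> nat list \<Rightarrow> bool" where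
  "block_sorted R w [] \<longleftrightarrow> w = []"
| "block_sorted R w (a # \<alpha>) \<longleftrightarrow> sorted_wrt R (take a w) \<and> block_sorted R (drop a w) \<alpha>"

lemma block_sorted_append:
  assumes "sum_list \<alpha> = m"
  shows "block_sorted R w (\<alpha> @ \<beta>) \<longleftrightarrow> block_sorted R (take m w) \<alpha> \<and> block_sorted R (drop m w) \<beta>"
  using assms
proof (induction \<alpha> arbitrary: w m)
  case (Cons a \<alpha>)
  then show ?case using Cons.IH[of "m - a" "drop a w"] by (auto simp: drop_take min_def add.commute)
qed auto

text \<open>By transitivity a block is sorted once its neighbours are, so exactly the positions that
  are not block boundaries matter. Position i compares the list entries i - 1 and i, which
  reconciles 1-based partial sums with 0-based indices.\<close>

lemma block_sorted_iff:
  assumes R: "transp R" and "\<alpha> \<in> Comp (length w)"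
  shows "block_sorted R w \<alpha> \<longleftrightarrow> (\<forall>i\<in>{1..<length w} - psums \<alpha>. R (w ! (i - 1)) (w ! i))"
  using assms(2)
proof (induction \<alpha> arbitrary: w)
  case (Cons a \<alpha>)
  have a: "0 < a" "a \<le> length w" and \<alpha>: "\<alpha> \<in> Comp (length w - a)" using Cons.prems by (auto simp: Cons_in_Comp)
  have first: "sorted_wrt R (take a w) \<longleftrightarrow> (\<forall>i\<in>{1..<a}. R (w ! (i - 1)) (w ! i))"
    unfolding sorted_wrt_iff_nth_Suc_transp[OF R]
  proof (intro iffI ballI allI impI)
    fix i assume *: "\<forall>i. Suc i < length (take a w) \<longrightarrow> R (take a w ! i) (take a w ! Suc i)" and i: "i \<in> {1..<a}"
    then obtain k where "i = Suc k" by (cases i) auto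
    then show "R (w ! (i - 1)) (w ! i)" using *[rule_format, of k] i a by simp
  next
    fix i assume "\<forall>i\<in>{1..<a}. R (w ! (i - 1)) (w ! i)" "Suc i < length (take a w)"
    then show "R (take a w ! i) (take a w ! Suc i)" using a by (auto dest!: bspec[of _ _ "Suc i"])
  qed
  show ?case
  proof (cases "\<alpha> = []")
    case True
    then have "length w = a" using \<alpha> a by simp
    then show ?thesis using first True a by auto
  next
    case False
    then have lt: "a < length w" using \<alpha> a by (cases \<alpha>) (auto simp: Cons_in_Comp)
    have "{1..<length w} - psums (a # \<alpha>) = {1..<a} \<union> (+) a ` ({1..<length w - a} - psums \<alpha>)" (is "?L = ?R")
    proof
      have nl: "i \<notin> psums (a # \<alpha>)" if "i < a" for i using that unfolding psums_Cons[OF False] by auto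
      show "?R \<subseteq> ?L" using nl lt unfolding psums_Cons[OF False] by auto
      show "?L \<subseteq> ?R"
      proof
        fix i assume i: "i \<in> ?L"
        show "i \<in> ?R"
        proof (cases "i < a")
          case False
          then have "i \<noteq> a" "i = a + (i - a)" using i psums_Cons[OF \<open>\<alpha> \<noteq> []\<close>] by auto
          moreover have "i - a \<notin> psums \<alpha>" using i False psums_Cons[OF \<open>\<alpha> \<noteq> []\<close>] by (metis DiffD2 calculation(2) imageI insertCI)
          ultimately show ?thesis using i False by (intro UnI2 image_eqI[of _ _ "i - a"]) auto
        qed (use i in auto)
      qed
    qed
    then have "(\<forall>i\<in>{1..<length w} - psums (a # \<alpha>). R (w ! (i - 1)) (w ! i)) \<longleftrightarrow>
      (\<forall>i\<in>{1..<a}. R (w ! (i - 1)) (w ! i)) \<and> (\<forall>i\<in>{1..<length w - a} - psums \<alpha>. R (w ! (a + i - 1)) (w ! (a + i)))"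
      by (simp add: ball_Un)
    also have "(\<forall>i\<in>{1..<length w - a} - psums \<alpha>. R (w ! (a + i - 1)) (w ! (a + i))) \<longleftrightarrow> block_sorted R (drop a w) \<alpha>"
    proof -
      have "drop a w ! (i - 1) = w ! (a + i - 1)" "drop a w ! i = w ! (a + i)" if "i \<in> {1..<length w - a}" for i
        using that a by (auto simp: nth_drop)
      then show ?thesis using Cons.IH[of "drop a w"] \<alpha> by auto
    qed
    finally show ?thesis using first by simp
  qed
qed simp

section \<open>The monomial basis\<close>

text \<open>The composition type of a monomial. Quasisymmetric functions are constant on monomials
  of the same type.\<close>

definition exps :: "monomial \<Rightarrow> nat list" where
  "exps m = map (Poly_Mapping.lookup m) (sorted_list_of_set (Poly_Mapping.keys m))"

text \<open>The representative of type \<alpha> in the first variables. On quasisymmetric functions,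
  evaluation at it is the coordinate functional of \<open>M \<alpha>\<close>, so
  \<open>f (pack \<alpha>)\<close> stands for a coefficient from here on.\<close>

definition pack :: "nat list \<Rightarrow> monomial" where
  "pack \<alpha> = xmono [0..<length \<alpha>] \<alpha>"

lemma lookup_xmono: "Poly_Mapping.lookup (xmono is \<alpha>) x = (\<Sum>j<length \<alpha>. \<alpha> ! j when is ! j = x)"
  by (simp add: xmono_def lookup_sum lookup_single)

lemma lookup_xmono_nth:
  assumes "distinct is" "length is = length \<alpha>" "j < length \<alpha>"
  shows "Poly_Mapping.lookup (xmono is \<alpha>) (is ! j) = \<alpha> ! j"
proof -
  have "Poly_Mapping.lookup (xmono is \<alpha>) (is ! j) = (\<Sum>k<length \<alpha>. if k = j then \<alpha> ! j else 0)"
    unfolding lookup_xmono by (rule sum.cong) (use assms in \<open>auto simp: when_def nth_eq_iff_index_eq\<close>)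
  then show ?thesis using assms by simp
qed

lemma lookup_xmono_notin: "length is = length \<alpha> \<Longrightarrow> x \<notin> set is \<Longrightarrow> Poly_Mapping.lookup (xmono is \<alpha>) x = 0"
  unfolding lookup_xmono by (rule sum.neutral) (auto simp: when_def)

lemma keys_xmono:
  assumes "distinct is" "length is = length \<alpha>" "\<alpha> \<in> compositions"
  shows "Poly_Mapping.keys (xmono is \<alpha>) = set is"
proof (rule set_eqI)
  fix x show "x \<in> Poly_Mapping.keys (xmono is \<alpha>) \<longleftrightarrow> x \<in> set is"
  proof (cases "x \<in> set is")
    case True
    then obtain j where j: "j < length \<alpha>" "x = is ! j" using assms(2) by (auto simp: in_set_conv_nth)
    have "\<alpha> ! j \<noteq> 0" using assms(3) j(1) by (metis compositions_def mem_Collect_eq nth_mem)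
    then show ?thesis using True lookup_xmono_nth[OF assms(1,2) j(1)] j(2) by (simp add: in_keys_iff)
  next
    case False
    then show ?thesis using lookup_xmono_notin[OF assms(2)] by (simp add: in_keys_iff)
  qed
qed

lemma exps_xmono:
  assumes "sorted_wrt (<) is" "length is = length \<alpha>" "\<alpha> \<in> compositions"
  shows "sorted_list_of_set (Poly_Mapping.keys (xmono is \<alpha>)) = is" "exps (xmono is \<alpha>) = \<alpha>"
proof -
  have d: "distinct is" "sorted is" using assms(1) by (auto simp: strict_sorted_iff)
  show s: "sorted_list_of_set (Poly_Mapping.keys (xmono is \<alpha>)) = is"
    unfolding keys_xmono[OF d(1) assms(2,3)] using d by (simp add: sorted_list_of_set.idem_if_sorted_distinct)
  show "exps (xmono is \<alpha>) = \<alpha>"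
    unfolding exps_def s by (rule nth_equalityI) (use assms d lookup_xmono_nth in auto)
qed

lemma xmono_exps: "xmono (sorted_list_of_set (Poly_Mapping.keys m)) (exps m) = m"
proof (rule poly_mapping_eqI)
  fix x
  let ?is = "sorted_list_of_set (Poly_Mapping.keys m)"
  have l: "length ?is = length (exps m)" by (simp add: exps_def)
  show "Poly_Mapping.lookup (xmono ?is (exps m)) x = Poly_Mapping.lookup m x"
  proof (cases "x \<in> set ?is")
    case True
    then obtain j where j: "j < length ?is" "x = ?is ! j" by (metis in_set_conv_nth)
    then show ?thesis using lookup_xmono_nth[OF _ l, of j] l by (simp add: exps_def)
  next
    case False
    then show ?thesis using lookup_xmono_notin[OF l] by (simp add: in_keys_iff)
  qed
qed

lemma exps_compositions: "exps m \<in> compositions"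
  by (auto simp: exps_def compositions_def in_keys_iff)

lemma exps_pack [simp]: "\<alpha> \<in> compositions \<Longrightarrow> exps (pack \<alpha>) = \<alpha>"
  unfolding pack_def by (rule exps_xmono) auto

text \<open>As \<alpha> has no zero part, an index sequence producing m must be the sorted support
  of m, so the count in the definition of \<open>M\<close> is 0 or 1.\<close>

lemma M_apply: 
  assumes "\<alpha> \<in> compositions"
  shows "M \<alpha> m = (if exps m = \<alpha> then 1 else 0)"
proof -
  have "{is. sorted_wrt (<) is \<and> length is = length \<alpha> \<and> xmono is \<alpha> = m} =
      (if exps m = \<alpha> then {sorted_list_of_set (Poly_Mapping.keys m)} else {})"
  proof (cases "exps m = \<alpha>")
    case True
    have "is = sorted_list_of_set (Poly_Mapping.keys m)"
      if "sorted_wrt (<) is" "length is = length \<alpha>" "xmono is \<alpha> = m" for "is"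
      using exps_xmono(1)[OF that(1,2) assms] that(3) by simp
    moreover have "xmono (sorted_list_of_set (Poly_Mapping.keys m)) \<alpha> = m"
      "length (sorted_list_of_set (Poly_Mapping.keys m)) = length \<alpha>"
      using xmono_exps[of m] True by (auto simp: exps_def)
    ultimately show ?thesis using True by auto
  next
    case False
    then show ?thesis using exps_xmono(2)[OF _ _ assms] by auto
  qed
  then show ?thesis by (simp add: M_def)
qed

lemma M_pack: "\<alpha> \<in> compositions \<Longrightarrow> \<beta> \<in> compositions \<Longrightarrow> M \<alpha> (pack \<beta>) = (if \<alpha> = \<beta> then 1 else 0)"
  by (auto simp: M_apply)

lemma M_basis: "inj_on M compositions" "rvs.independent (M ` compositions)"
  by (rule triangular_independent[where p = pack and r = "\<lambda>_. 0"]; auto simp: M_pack split: if_splits)+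

lemma QSym_eq: "QSym = rvs.span (M ` compositions)"
proof -
  have "M ` compositions \<subseteq> (\<Union>n. QSym_deg n)"
    unfolding QSym_deg_def by (auto simp: Comp_def intro!: rvs.span_base)
  moreover have "QSym_deg n \<subseteq> rvs.span (M ` compositions)" for n
    unfolding QSym_deg_def by (rule rvs.span_mono) (auto simp: Comp_def)
  ultimately show ?thesis
    unfolding QSym_def by (intro antisym rvs.span_mono rvs.span_minimal UN_least rvs.subspace_span)
qed

lemma QSym_deg_subset: "QSym_deg n \<subseteq> QSym"
  unfolding QSym_deg_def QSym_eq by (rule rvs.span_mono) (auto simp: Comp_def)

lemma M_in_QSym_deg: "\<alpha> \<in> Comp n \<Longrightarrow> M \<alpha> \<in> QSym_deg n"
  unfolding QSym_deg_def by (rule rvs.span_base) auto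

lemma M_in_QSym: "\<alpha> \<in> compositions \<Longrightarrow> M \<alpha> \<in> QSym"
  unfolding QSym_eq by (rule rvs.span_base) auto

text \<open>Evaluation at \<open>p j\<close> kills every basis vector except \<open>e j\<close>, so
  only one term of the finite expansion survives. It serves both the M basis and its tensor
  square.\<close>

lemma representation_eval:
  fixes e :: "'i \<Rightarrow> 'x \<Rightarrow> rat"
  assumes inj: "inj_on e J" and ind: "rvs.independent (e ` J)" and f: "f \<in> rvs.span (e ` J)"
    and ev: "\<And>i j. i \<in> J \<Longrightarrow> j \<in> J \<Longrightarrow> e i (p j) = (if i = j then 1 else 0)" and j: "j \<in> J"
  shows "rvs.representation (e ` J) f (e j) = f (p j)"
proof -
  define r where "r = rvs.representation (e ` J) f"
  let ?S = "{b. r b \<noteq> 0}"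
  have fin: "finite ?S" unfolding r_def by (rule rvs.finite_representation)
  have sub: "?S \<subseteq> e ` J" unfolding r_def using rvs.representation_ne_zero by auto
  have "f = (\<Sum>b\<in>?S. scale (r b) b)" unfolding r_def using rvs.sum_nonzero_representation_eq[OF ind f] by simp
  then have "f (p j) = (\<Sum>b\<in>?S. r b * b (p j))" by (metis (no_types, lifting) scale_apply sum.cong sum_fun_apply)
  also have "\<dots> = (\<Sum>b\<in>?S. if b = e j then r (e j) else 0)"
  proof (rule sum.cong[OF refl])
    fix b assume "b \<in> ?S"
    then obtain i where "i \<in> J" "b = e i" using sub by auto
    then show "r b * b (p j) = (if b = e j then r (e j) else 0)"
      using ev[of i j] j inj by (auto simp: inj_on_eq_iff)
  qed
  also have "\<dots> = r (e j)" using fin by simp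
  finally show ?thesis by (simp add: r_def)
qed

lemma M_coeff_eq: "f \<in> QSym \<Longrightarrow> \<alpha> \<in> compositions \<Longrightarrow> M_coeff f \<alpha> = f (pack \<alpha>)"
  unfolding M_coeff_def QSym_eq by (rule representation_eval[OF M_basis]) (auto simp: M_pack)

lemma finite_M_coeff: "f \<in> QSym \<Longrightarrow> finite {\<alpha> \<in> compositions. f (pack \<alpha>) \<noteq> 0}"
proof -
  assume f: "f \<in> QSym"
  have "finite (M ` {\<alpha> \<in> compositions. f (pack \<alpha>) \<noteq> 0})"
  proof (rule finite_subset)
    show "M ` {\<alpha> \<in> compositions. f (pack \<alpha>) \<noteq> 0} \<subseteq> {b. rvs.representation (M ` compositions) f b \<noteq> 0}"
      using M_coeff_eq[OF f] by (auto simp: M_coeff_def)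
  qed (rule rvs.finite_representation)
  then show ?thesis by (rule finite_imageD) (rule inj_on_subset[OF M_basis(1)], auto)
qed

lemma M_basis_deg: "inj_on M (Comp n)" "rvs.independent (M ` Comp n)"
proof -
  have "Comp n \<subseteq> compositions" by (auto simp: Comp_def)
  then show "inj_on M (Comp n)" "rvs.independent (M ` Comp n)"
    using inj_on_subset[OF M_basis(1)] rvs.independent_mono[OF M_basis(2)] by (simp_all add: image_mono)
qed

lemma lin_comb_M_pack: "\<alpha> \<in> Comp n \<Longrightarrow> lin_comb (Comp n) M c (pack \<alpha>) = c \<alpha>"
proof -
  assume \<alpha>: "\<alpha> \<in> Comp n"
  have "lin_comb (Comp n) M c (pack \<alpha>) = (\<Sum>\<beta>\<in>Comp n. c \<beta> * M \<beta> (pack \<alpha>))"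
    by (simp add: lin_comb_def sum_fun_apply)
  also have "\<dots> = (\<Sum>\<beta>\<in>Comp n. if \<beta> = \<alpha> then c \<alpha> else 0)"
    using \<alpha> by (intro sum.cong) (auto simp: M_pack Comp_compositions)
  finally show ?thesis using \<alpha> finite_Comp[of n] by simp
qed

lemma QSym_deg_expand: "f \<in> QSym_deg n \<Longrightarrow> f = lin_comb (Comp n) M (\<lambda>\<beta>. f (pack \<beta>))"
proof -
  assume "f \<in> QSym_deg n"
  then obtain c where c: "f = lin_comb (Comp n) M c"
    unfolding QSym_deg_def lin_comb_image[OF finite_Comp, symmetric] by auto
  have "lin_comb (Comp n) M (\<lambda>\<beta>. f (pack \<beta>)) = lin_comb (Comp n) M c"
    unfolding lin_comb_def by (intro sum.cong refl) (simp add: lin_comb_M_pack c)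
  then show ?thesis using c by simp
qed

lemma QSym_deg_zero: "f \<in> QSym_deg n \<Longrightarrow> \<alpha> \<in> compositions \<Longrightarrow> \<alpha> \<notin> Comp n \<Longrightarrow> f (pack \<alpha>) = 0"
proof -
  assume f: "f \<in> QSym_deg n" and \<alpha>: "\<alpha> \<in> compositions" "\<alpha> \<notin> Comp n"
  have "f (pack \<alpha>) = (\<Sum>\<beta>\<in>Comp n. f (pack \<beta>) * M \<beta> (pack \<alpha>))"
    by (subst QSym_deg_expand[OF f]) (simp add: lin_comb_def sum_fun_apply)
  also have "\<dots> = 0" by (rule sum.neutral) (use \<alpha> in \<open>auto simp: M_pack Comp_compositions\<close>)
  finally show ?thesis .
qed

text \<open>The intrinsic description of quasisymmetric functions of degree n. It yields the
  expansion of a series that is known only through counting.\<close>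

lemma quasisymmetric_expand:
  assumes hom: "\<And>m. f m \<noteq> 0 \<Longrightarrow> sum_list (exps m) = n"
    and qs: "\<And>m. f m = f (pack (exps m))"
  shows "f = lin_comb (Comp n) M (\<lambda>\<beta>. f (pack \<beta>))"
proof
  fix m
  have "lin_comb (Comp n) M (\<lambda>\<beta>. f (pack \<beta>)) m = (\<Sum>\<beta>\<in>Comp n. if \<beta> = exps m then f (pack (exps m)) else 0)"
    unfolding lin_comb_def sum_fun_apply by (intro sum.cong) (auto simp: M_apply Comp_compositions)
  also have "\<dots> = f m"
    using finite_Comp[of n] qs[of m] hom[of m] exps_compositions[of m] by (auto simp: Comp_def)
  finally show "f m = lin_comb (Comp n) M (\<lambda>\<beta>. f (pack \<beta>)) m" ..
qed

section \<open>Labellings of words\<close>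

text \<open>Being block-sorted depends only on comparisons, so it survives order-preserving
  relabellings, also between different types.\<close>

lemma block_sorted_map:
  assumes "\<And>x y. x \<in> set w \<Longrightarrow> y \<in> set w \<Longrightarrow> R (h x) (h y) \<longleftrightarrow> S x y"
  shows "block_sorted R (map h w) \<alpha> \<longleftrightarrow> block_sorted S w \<alpha>"
  using assms
proof (induction \<alpha> arbitrary: w)
  case (Cons a \<alpha>)
  have "sorted_wrt R (map h (take a w)) \<longleftrightarrow> sorted_wrt S (take a w)"
    unfolding sorted_wrt_iff_nth_less using Cons.prems by (auto dest!: in_set_takeD)
  moreover have "block_sorted R (map h (drop a w)) \<alpha> \<longleftrightarrow> block_sorted S (drop a w) \<alpha>"
    using Cons.prems by (intro Cons.IH) (auto dest!: in_set_dropD)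
  ultimately show ?case by (simp add: take_map drop_map)
qed simp

definition cont :: "nat list \<Rightarrow> monomial" where
  "cont g = (\<Sum>x\<leftarrow>g. Poly_Mapping.single x 1)"

lemma cont_simps [simp]: "cont [] = 0" "cont (x # g) = Poly_Mapping.single x 1 + cont g" "cont (g @ h) = cont g + cont h"
  by (simp_all add: cont_def)

lemma lookup_cont: "Poly_Mapping.lookup (cont g) x = count (mset g) x"
  by (induction g) (auto simp: lookup_add lookup_single)

lemma keys_cont: "Poly_Mapping.keys (cont g) = set g"
  by (auto simp: in_keys_iff lookup_cont)

lemma cont_eq_iff: "cont g = cont h \<longleftrightarrow> mset g = mset h"
  by (auto simp: poly_mapping_eq_iff multiset_eq_iff lookup_cont fun_eq_iff)

lemma sum_list_exps_cont: "sum_list (exps (cont g)) = length g"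
proof -
  have "sum_list (exps (cont g)) = (\<Sum>x\<in>set g. count (mset g) x)"
    by (simp add: exps_def keys_cont lookup_cont[abs_def] sum_list_distinct_conv_sum_set)
  also have "\<dots> = length g" using size_multiset_overloaded_eq[of "mset g"] by simp
  finally show ?thesis .
qed

text \<open>For k = 0 this is the only weakly increasing word with content
  \<open>pack \<alpha>\<close>. The offset k serves the recursion.\<close>

fun block_word :: "nat \<Rightarrow> nat list \<Rightarrow> nat list" where
  "block_word k [] = []"
| "block_word k (a # \<alpha>) = replicate a k @ block_word (Suc k) \<alpha>"

lemma length_block_word [simp]: "length (block_word k \<alpha>) = sum_list \<alpha>"
  by (induction \<alpha> arbitrary: k) auto

lemma block_word_ge: "x \<in> set (block_word k \<alpha>) \<Longrightarrow> k \<le> x"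
  by (induction \<alpha> arbitrary: k) force+

lemma sorted_block_word: "sorted (block_word k \<alpha>)"
  by (induction \<alpha> arbitrary: k) (auto simp: sorted_append dest: block_word_ge)

lemma xmono_Cons: "xmono (i # is) (a # \<alpha>) = Poly_Mapping.single i a + xmono is \<alpha>"
  by (simp add: xmono_def sum.lessThan_Suc_shift del: sum.lessThan_Suc)

lemma cont_replicate: "cont (replicate a k) = Poly_Mapping.single k a"
  by (induction a) (auto simp: single_add[symmetric])

lemma cont_block_word: "cont (block_word k \<alpha>) = xmono [k..<k + length \<alpha>] \<alpha>"
proof (induction \<alpha> arbitrary: k)
  case Nil
  then show ?case by (simp add: xmono_def)
next
  case (Cons a \<alpha>)
  have "[k..<k + length (a # \<alpha>)] = k # [Suc k..<Suc k + length \<alpha>]" by (subst upt_conv_Cons) auto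
  then show ?case using Cons.IH[of "Suc k"] by (simp only: xmono_Cons) (simp add: cont_replicate)
qed

lemma cont_eq_pack: "cont g = pack \<alpha> \<longleftrightarrow> mset g = mset (block_word 0 \<alpha>)"
  using cont_block_word[of 0 \<alpha>] by (simp add: pack_def cont_eq_iff[symmetric])

text \<open>Across blocks the first components already increase. Inside a block they agree, so the
  lexicographic order falls back on the letters of w.\<close>

lemma sorted_zip_block_word:
  assumes "length w = sum_list \<alpha>"
  shows "sorted_wrt (<) (zip (block_word k \<alpha>) w) \<longleftrightarrow> block_sorted (<) (w :: nat list) \<alpha>"
  using assms
proof (induction \<alpha> arbitrary: k w)
  case (Cons a \<alpha>)
  have a: "a \<le> length w" using Cons.prems by simp
  have z: "zip (block_word k (a # \<alpha>)) w = map (Pair k) (take a w) @ zip (block_word (Suc k) \<alpha>) (drop a w)"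
    using a by (simp add: zip_append1 zip_replicate1 min_def)
  have "sorted_wrt (<) (map (Pair k) (take a w)) \<longleftrightarrow> sorted_wrt (<) (take a w)"
    by (simp add: sorted_wrt_map)
  moreover have "x < y" if "x \<in> set (map (Pair k) (take a w))" "y \<in> set (zip (block_word (Suc k) \<alpha>) (drop a w))" for x y
  proof -
    obtain y1 y2 where y: "y = (y1, y2)" by (cases y)
    then have "Suc k \<le> y1" using that(2) block_word_ge[of y1 "Suc k" \<alpha>] set_zip_leftD by fastforce
    then show ?thesis using that(1) y by auto
  qed
  ultimately show ?case unfolding z sorted_wrt_append using Cons.IH[of "drop a w" "Suc k"] Cons.prems by auto
qed simp

text \<open>A labelling \<open>g\<close> of the word \<open>w\<close> is weakly increasing on the blocks of \<open>\<alpha>\<close> and strictly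
  increasing at the descents of \<open>w\<close> there iff the pairs \<open>(g\<^sub>i, w\<^sub>i)\<close> increase lexicographically on
  the blocks. So \<open>labellings w \<alpha>\<close> is a product of fundamental quasisymmetric functions, one for
  each block.\<close>

definition labels :: "nat list \<Rightarrow> nat list \<Rightarrow> monomial \<Rightarrow> nat list set" where
  "labels w \<alpha> m = {g. length g = length w \<and> cont g = m \<and> block_sorted (<) (zip g w) \<alpha>}"

definition labellings :: "nat list \<Rightarrow> nat list \<Rightarrow> pseries" where
  "labellings w \<alpha> = (\<lambda>m. of_nat (card (labels w \<alpha> m)))"

lemma finite_labels: "finite (labels w \<alpha> m)"
proof (rule finite_subset)
  show "labels w \<alpha> m \<subseteq> {g. set g \<subseteq> Poly_Mapping.keys m \<and> length g = length w}"
    by (auto simp: labels_def keys_cont)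
qed (rule finite_lists_length_eq, simp)

text \<open>A divisor of m has its support inside that of m and bounded exponents, and it determines
  its cofactor.\<close>

lemma finite_splits: "finite {(u, v). u + v = (m :: monomial)}"
proof -
  let ?A = "{u. \<exists>v. u + v = m}"
  have "finite (Poly_Mapping.lookup ` ?A)"
  proof (rule finite_subset)
    define N where "N = Max (insert 0 (Poly_Mapping.lookup m ` Poly_Mapping.keys m))"
    have le: "Poly_Mapping.lookup m x \<le> N" if "x \<in> Poly_Mapping.keys m" for x
      unfolding N_def by (rule Max_ge) (use that in auto)
    show "Poly_Mapping.lookup ` ?A \<subseteq>
        {f. \<forall>x. (x \<in> Poly_Mapping.keys m \<longrightarrow> f x \<in> {..N}) \<and> (x \<notin> Poly_Mapping.keys m \<longrightarrow> f x = 0)}"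
    proof clarify
      fix u v x assume m: "m = u + v"
      then have "Poly_Mapping.lookup u x \<le> Poly_Mapping.lookup m x" by (simp add: lookup_add)
      then show "(x \<in> Poly_Mapping.keys (u + v) \<longrightarrow> Poly_Mapping.lookup u x \<in> {..N}) \<and>
          (x \<notin> Poly_Mapping.keys (u + v) \<longrightarrow> Poly_Mapping.lookup u x = 0)"
        using le[of x] by (auto simp: m[symmetric] in_keys_iff)
    qed
  qed (rule finite_set_of_finite_funs, auto)
  then have "finite ?A" by (rule finite_imageD) (rule inj_onI, simp only: lookup_inject)
  moreover have "{(u, v). u + v = m} \<subseteq> (\<lambda>u. (u, m - u)) ` ?A" by auto
  ultimately show ?thesis using finite_subset[OF _ finite_imageI] by blast
qed

text \<open>The conditions on the first block and on the remaining blocks are independent, while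
  contents multiply. Cutting a labelling after position a thus turns the count into a convolution,
  which is the product of series.\<close>

lemma labellings_Cons:
  assumes "a \<le> length w"
  shows "labellings w (a # \<alpha>) = ps_mult (labellings (take a w) [a]) (labellings (drop a w) \<alpha>)"
proof
  fix m :: monomial
  let ?P = "{(u, v). u + v = m}"
  define C where "C = (\<lambda>(u, v). labels (take a w) [a] u \<times> labels (drop a w) \<alpha> v)"
  have mem: "g @ h \<in> labels w (a # \<alpha>) m \<longleftrightarrow> (g, h) \<in> (\<Union>p\<in>?P. C p)" if "length g = a" for g h
  proof -
    have z: "zip (g @ h) w = zip g (take a w) @ zip h (drop a w)" using that by (simp add: zip_append1)
    have "length (zip g (take a w)) = a" using that assms by simp
    then have "block_sorted (<) (zip (g @ h) w) (a # \<alpha>) \<longleftrightarrow>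
        block_sorted (<) (zip g (take a w)) [a] \<and> block_sorted (<) (zip h (drop a w)) \<alpha>"
      unfolding z by simp
    then show ?thesis using that assms by (auto simp: labels_def C_def)
  qed
  have "labels w (a # \<alpha>) m = (\<lambda>(g, h). g @ h) ` (\<Union>p\<in>?P. C p)"
  proof
    show "labels w (a # \<alpha>) m \<subseteq> (\<lambda>(g, h). g @ h) ` (\<Union>p\<in>?P. C p)"
    proof
      fix x assume x: "x \<in> labels w (a # \<alpha>) m"
      then have "length (take a x) = a" using assms by (simp add: labels_def)
      from mem[OF this, of "drop a x"] x have "(take a x, drop a x) \<in> (\<Union>p\<in>?P. C p)" by simp
      then show "x \<in> (\<lambda>(g, h). g @ h) ` (\<Union>p\<in>?P. C p)" by (rule rev_image_eqI) simp
    qed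
    show "(\<lambda>(g, h). g @ h) ` (\<Union>p\<in>?P. C p) \<subseteq> labels w (a # \<alpha>) m"
    proof (rule image_subsetI)
      fix x assume x: "x \<in> (\<Union>p\<in>?P. C p)"
      obtain g h where gh: "x = (g, h)" by (cases x)
      then have "length g = a" using x assms by (auto simp: C_def labels_def)
      from mem[OF this, of h] x gh show "(\<lambda>(g, h). g @ h) x \<in> labels w (a # \<alpha>) m" by simp
    qed
  qed
  moreover have "inj_on (\<lambda>(g, h). g @ h) (\<Union>p\<in>?P. C p)"
  proof (rule inj_onI)
    fix x y assume *: "x \<in> (\<Union>p\<in>?P. C p)" "y \<in> (\<Union>p\<in>?P. C p)" "(\<lambda>(g, h). g @ h) x = (\<lambda>(g, h). g @ h) y"
    have "length (fst x) = a" "length (fst y) = a" using *(1,2) assms by (auto simp: C_def labels_def)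
    then show "x = y" using *(3) by (auto simp: case_prod_beta prod_eq_iff)
  qed
  ultimately have "card (labels w (a # \<alpha>) m) = card (\<Union>p\<in>?P. C p)" by (simp add: card_image)
  also have "\<dots> = (\<Sum>p\<in>?P. card (C p))"
  proof (rule card_UN_disjoint)
    show "finite ?P" by (rule finite_splits)
    show "\<forall>i\<in>?P. finite (C i)" by (auto simp: C_def finite_labels)
    show "\<forall>i\<in>?P. \<forall>j\<in>?P. i \<noteq> j \<longrightarrow> C i \<inter> C j = {}" by (auto simp: C_def labels_def)
  qed
  finally show "labellings w (a # \<alpha>) m = ps_mult (labellings (take a w) [a]) (labellings (drop a w) \<alpha>) m"
    by (simp add: labellings_def ps_mult_def C_def case_prod_beta card_cartesian_product)
qed

lemma labellings_homogeneous: "labellings w \<alpha> m \<noteq> 0 \<Longrightarrow> sum_list (exps m) = length w"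
proof -
  assume "labellings w \<alpha> m \<noteq> 0"
  then have "labels w \<alpha> m \<noteq> {}" by (auto simp: labellings_def)
  then obtain g where "length g = length w" "cont g = m" by (auto simp: labels_def)
  then show ?thesis using sum_list_exps_cont[of g] by simp
qed

text \<open>The order isomorphism from an initial segment of the naturals to the support of m
  relabels one set of labellings into the other: lexicographic comparisons are preserved and the
  content \<open>pack (exps m)\<close> becomes m.\<close>

lemma labellings_quasisymmetric: "labellings w \<alpha> m = labellings w \<alpha> (pack (exps m))"
proof -
  define s where "s = sorted_list_of_set (Poly_Mapping.keys m)"
  define b where "b = block_word 0 (exps m)"
  have s: "sorted_wrt (<) s" "length s = length (exps m)" by (simp_all add: s_def exps_def)
  have keys: "Poly_Mapping.keys (pack (exps m)) = {0..<length s}"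
    unfolding pack_def by (subst keys_xmono) (auto simp: s exps_compositions)
  have sg: "set g = {0..<length s}" if "cont g = pack (exps m)" for g
    using keys keys_cont[of g] that by simp
  have lt: "s ! i < s ! j \<longleftrightarrow> i < j" if "i < length s" "j < length s" for i j
    using s(1) that unfolding sorted_wrt_iff_nth_less by (metis less_asym' linorder_neqE_nat)
  have cm: "cont (map ((!) s) g) = m" if "cont g = pack (exps m)" for g
  proof (rule poly_mapping_eqI)
    fix x
    note sg = sg[OF that]
    show "Poly_Mapping.lookup (cont (map ((!) s) g)) x = Poly_Mapping.lookup m x"
    proof (cases "x \<in> set s")
      case True
      then obtain j where j: "j < length s" "x = s ! j" by (metis in_set_conv_nth)
      have "count (image_mset ((!) s) (mset g)) x = (\<Sum>i\<in>{i\<in>set g. s ! i = x}. count (mset g) i)"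
        by (simp add: count_image_mset vimage_def Int_def conj_commute)
      also have "{i\<in>set g. s ! i = x} = {j}" using j lt by (auto simp: sg) (metis less_irrefl linorder_neqE_nat)
      finally have "Poly_Mapping.lookup (cont (map ((!) s) g)) x = Poly_Mapping.lookup (pack (exps m)) j"
        by (simp add: lookup_cont that[symmetric])
      also have "\<dots> = exps m ! j"
        using lookup_xmono_nth[of "[0..<length (exps m)]" "exps m" j] j s(2) by (simp add: pack_def)
      also have "\<dots> = Poly_Mapping.lookup m x" using j s(2) by (simp add: exps_def s_def)
      finally show ?thesis .
    next
      case False
      then have "x \<notin> set (map ((!) s) g)" using sg by auto
      then have "Poly_Mapping.lookup (cont (map ((!) s) g)) x = 0"
        using keys_cont[of "map ((!) s) g"] in_keys_iff by metis
      then show ?thesis using False by (simp add: s_def in_keys_iff)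
    qed
  qed
  have bs: "block_sorted (<) (zip (map ((!) s) g) w) \<alpha> \<longleftrightarrow> block_sorted (<) (zip g w) \<alpha>" if "set g \<subseteq> {0..<length s}" for g
    unfolding zip_map1
  proof (rule block_sorted_map)
    fix x y assume "x \<in> set (zip g w)" "y \<in> set (zip g w)"
    then have "fst x \<in> set g" "fst y \<in> set g" using set_zip_leftD[of "fst x" "snd x" g w] set_zip_leftD[of "fst y" "snd y" g w] by simp_all
    then have "fst x < length s" "fst y < length s" using that by auto
    then show "(case x of (x, y) \<Rightarrow> (s ! x, y)) < (case y of (x, y) \<Rightarrow> (s ! x, y)) \<longleftrightarrow> x < y"
      using lt[of "fst x" "fst y"] lt[of "fst y" "fst x"]
      by (auto simp: case_prod_beta less_prod_def' le_less)
  qed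
  have "bij_betw (map ((!) s)) (labels w \<alpha> (pack (exps m))) (labels w \<alpha> m)"
    unfolding bij_betw_def
  proof
    have inj: "inj_on ((!) s) {0..<length s}"
      by (rule inj_onI) (metis atLeastLessThan_iff less_irrefl linorder_neqE_nat lt)
    show "inj_on (map ((!) s)) (labels w \<alpha> (pack (exps m)))"
    proof (rule inj_onI)
      fix g h assume *: "g \<in> labels w \<alpha> (pack (exps m))" "h \<in> labels w \<alpha> (pack (exps m))" "map ((!) s) g = map ((!) s) h"
      then have "set g = {0..<length s}" "set h = {0..<length s}" using sg by (simp_all add: labels_def)
      then show "g = h" using *(3) inj by (simp add: inj_on_map_eq_map)
    qed
    show "map ((!) s) ` labels w \<alpha> (pack (exps m)) = labels w \<alpha> m"
    proof
      show "map ((!) s) ` labels w \<alpha> (pack (exps m)) \<subseteq> labels w \<alpha> m"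
      proof (rule image_subsetI)
        fix g assume g: "g \<in> labels w \<alpha> (pack (exps m))"
        then have "set g = {0..<length s}" using sg by (simp add: labels_def)
        then show "map ((!) s) g \<in> labels w \<alpha> m" using g cm bs by (simp add: labels_def)
      qed
      show "labels w \<alpha> m \<subseteq> map ((!) s) ` labels w \<alpha> (pack (exps m))"
      proof
        fix h assume h: "h \<in> labels w \<alpha> m"
        have sh: "set h = set s" using h keys_cont[of h] by (simp add: labels_def s_def)
        define g where "g = map (inv_into {0..<length s} ((!) s)) h"
        have im: "(!) s ` {0..<length s} = set s" by (metis map_nth set_map set_upt)
        have hg: "map ((!) s) g = h"
          unfolding g_def map_map using sh im by (intro map_idI) (simp add: f_inv_into_f)
        have sg: "set g \<subseteq> {0..<length s}" using sh im by (auto simp: g_def intro: inv_into_into)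
        \<comment> \<open>Relabelling is injective on multisets over the initial segment. As the
          images of g and b both have content m, the words g and b have the same content.\<close>
        have "mset g = mset b"
        proof -
          have "cont (map ((!) s) b) = m" by (rule cm) (simp add: b_def cont_eq_pack)
          then have "image_mset ((!) s) (mset g) = image_mset ((!) s) (mset b)"
            using h hg cont_eq_iff[of h "map ((!) s) b"] by (simp add: labels_def flip: mset_map)
          moreover have "set b = {0..<length s}" using keys keys_cont[of b] cont_eq_pack[of b "exps m"] by (simp add: b_def)
          ultimately show ?thesis
            using multiset.inj_map_strong[of "mset g" "mset b" "(!) s" "(!) s"] sg inj
            by (auto simp: inj_on_def subset_iff)
        qed
        then have "cont g = pack (exps m)" by (simp add: cont_eq_pack b_def)
        moreover have "length g = length w" using h by (simp add: g_def labels_def)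
        moreover have "block_sorted (<) (zip g w) \<alpha>" using bs[OF sg] hg h by (simp add: labels_def)
        ultimately have "g \<in> labels w \<alpha> (pack (exps m))" by (simp add: labels_def)
        then show "h \<in> map ((!) s) ` labels w \<alpha> (pack (exps m))" using hg by (metis imageI)
      qed
    qed
  qed
  then show ?thesis by (simp add: labellings_def bij_betw_same_card)
qed

lemma labellings_expand: "labellings w \<alpha> = lin_comb (Comp (length w)) M (\<lambda>\<beta>. labellings w \<alpha> (pack \<beta>))"
  by (rule quasisymmetric_expand[of "labellings w \<alpha>" "length w"])
     (fact labellings_homogeneous labellings_quasisymmetric)+

lemma labellings_in_QSym_deg: "labellings w \<alpha> \<in> QSym_deg (length w)"
  unfolding QSym_deg_def
  by (subst labellings_expand, unfold lin_comb_def) (intro rvs.span_sum rvs.span_scale rvs.span_base imageI)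

text \<open>For distinct letters this is the M expansion of the fundamental function of the descent
  set of w. A labelling with one block is weakly increasing, so its content leaves
  \<open>block_word 0 \<delta>\<close> as the only candidate.\<close>

lemma labellings_one_block:
  assumes "\<delta> \<in> Comp (length w)"
  shows "labellings w (one_part (length w)) (pack \<delta>) = (if block_sorted (<) w \<delta> then 1 else 0)"
proof -
  have sl: "sum_list \<delta> = length w" using assms by (simp add: Comp_def)
  have one: "block_sorted (<) (zip g w) (one_part (length w)) \<longleftrightarrow> sorted_wrt (<) (zip g w)" if "length g = length w" for g
    using that by (auto simp: one_part_def)
  have "g = block_word 0 \<delta>" if "g \<in> labels w (one_part (length w)) (pack \<delta>)" for g
  proof -
    have g: "length g = length w" "mset g = mset (block_word 0 \<delta>)" "sorted_wrt (<) (zip g w)"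
      using that one by (auto simp: labels_def cont_eq_pack)
    have "sorted g" unfolding sorted_iff_nth_mono_less
    proof (intro allI impI)
      fix i j assume "i < j" "j < length g"
      then have "zip g w ! i < zip g w ! j" using g by (auto simp: sorted_wrt_iff_nth_less)
      then show "g ! i \<le> g ! j" using \<open>i < j\<close> \<open>j < length g\<close> g(1) by auto
    qed
    then show ?thesis using g(2) sorted_block_word properties_for_sort by metis
  qed
  moreover have "block_word 0 \<delta> \<in> labels w (one_part (length w)) (pack \<delta>) \<longleftrightarrow> block_sorted (<) w \<delta>"
    using one[of "block_word 0 \<delta>"] sl sorted_zip_block_word[of w \<delta> 0] by (simp add: labels_def cont_eq_pack)
  ultimately have "labels w (one_part (length w)) (pack \<delta>) = (if block_sorted (<) w \<delta> then {block_word 0 \<delta>} else {})"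
    by auto
  then show ?thesis by (simp add: labellings_def)
qed

section \<open>The basis X of the descent algebra and its product\<close>

definition word :: "nat \<Rightarrow> (nat \<Rightarrow> nat) \<Rightarrow> nat list" where
  "word n \<sigma> = map \<sigma> [1..<Suc n]"

lemma length_word [simp]: "length (word n \<sigma>) = n"
  by (simp add: word_def)

lemma nth_word: "i < n \<Longrightarrow> word n \<sigma> ! i = \<sigma> (Suc i)"
  by (simp add: word_def nth_append del: upt_Suc)

lemma mset_word: "\<sigma> permutes {1..n} \<Longrightarrow> mset (word n \<sigma>) = mset [1..<Suc n]"
proof -
  assume p: "\<sigma> permutes {1..n}"
  have "mset [1..<Suc n] = mset_set {1..n}" by (metis atLeastLessThanSuc_atLeastAtMost mset_upt)
  moreover have "image_mset \<sigma> (mset_set {1..n}) = mset_set (\<sigma> ` {1..n})"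
    by (rule image_mset_mset_set) (use p permutes_inj_on in blast)
  ultimately show ?thesis using permutes_image[OF p] by (simp add: word_def del: upt_Suc)
qed

lemma set_word: "\<sigma> permutes {1..n} \<Longrightarrow> set (word n \<sigma>) = {1..n}"
  using arg_cong[OF mset_word, of \<sigma> n set_mset] by auto

lemma distinct_word: "\<sigma> permutes {1..n} \<Longrightarrow> distinct (word n \<sigma>)"
  using mset_eq_imp_distinct_iff[OF mset_word, of \<sigma> n] by simp

lemma word_inj:
  assumes "\<sigma> permutes {1..n}" "\<tau> permutes {1..n}" "word n \<sigma> = word n \<tau>"
  shows "\<sigma> = \<tau>"
proof
  fix i show "\<sigma> i = \<tau> i"
  proof (cases "i \<in> {1..n}")
    case True
    then show ?thesis using assms(3) nth_word[of "i - 1" n \<sigma>] nth_word[of "i - 1" n \<tau>] by auto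
  next
    case False
    then show ?thesis using assms(1,2) by (metis permutes_not_in)
  qed
qed

lemma word_surj:
  assumes "mset s = mset [1..<Suc n]"
  obtains \<sigma> where "\<sigma> permutes {1..n}" "word n \<sigma> = s"
proof
  define \<sigma> where "\<sigma> i = (if i \<in> {1..n} then s ! (i - 1) else i)" for i
  have len: "length s = n" using arg_cong[OF assms, of size] by simp
  show w: "word n \<sigma> = s"
    by (rule nth_equalityI) (auto simp: len nth_word \<sigma>_def)
  have d: "distinct s" using mset_eq_imp_distinct_iff[OF assms] by simp
  have s: "set s = {1..n}" using arg_cong[OF assms, of set_mset] by auto
  show "\<sigma> permutes {1..n}"
  proof (rule bij_imp_permutes)
    show "\<sigma> x = x" if "x \<notin> {1..n}" for x using that by (auto simp: \<sigma>_def)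
    have "inj_on \<sigma> {1..n}"
      by (rule inj_onI) (use d len in \<open>auto simp: \<sigma>_def nth_eq_iff_index_eq\<close>)
    moreover have "\<sigma> ` {1..n} = {1..n}" using s unfolding w[symmetric] by (simp add: word_def atLeastLessThanSuc_atLeastAtMost del: upt_Suc)
    ultimately show "bij_betw \<sigma> {1..n} {1..n}" by (simp add: bij_betw_def)
  qed
qed

definition descents :: "nat list \<Rightarrow> nat set" where
  "descents w = {i \<in> {1..<length w}. w ! (i - 1) > w ! i}"

lemma block_sorted_descents:
  assumes "\<alpha> \<in> Comp (length w)" "distinct w"
  shows "block_sorted (<) w \<alpha> \<longleftrightarrow> descents w \<subseteq> psums \<alpha>"
proof -
  have "w ! (i - 1) \<noteq> w ! i" if "i \<in> {1..<length w}" for i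
    using that assms(2) by (auto simp: nth_eq_iff_index_eq)
  then have *: "w ! (i - 1) < w ! i \<longleftrightarrow> i \<notin> descents w" if "i \<in> {1..<length w}" for i
    using that by (force simp: descents_def)
  show ?thesis
    unfolding block_sorted_iff[OF transp_on_less assms(1)] using * by (auto simp: descents_def)
qed

text \<open>Eliminates \<open>co\<close>: the order on compositions sees only partial sums, and
  those of \<open>D n \<sigma>\<close> are the descents of \<sigma>.\<close>

lemma X_eq:
  assumes "\<alpha> \<in> Comp n"
  shows "X n \<alpha> \<sigma> = (if \<sigma> permutes {1..n} \<and> block_sorted (<) (word n \<sigma>) \<alpha> then 1 else 0)"
proof -
  have "psums (D n \<sigma>) = {i \<in> {1..<n}. \<sigma> i > \<sigma> (i + 1)}"
    unfolding D_def by (rule psums_co) auto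
  also have "\<dots> = descents (word n \<sigma>)"
    by (auto simp: descents_def nth_word)
  finally have "comp_le (D n \<sigma>) \<alpha> \<longleftrightarrow> descents (word n \<sigma>) \<subseteq> psums \<alpha>" by (simp add: comp_le_def)
  then show ?thesis using block_sorted_descents[of \<alpha> "word n \<sigma>"] assms distinct_word by (auto simp: X_def)
qed

text \<open>Increasing runs of lengths \<alpha>, each lying entirely below the one before it. For a
  composition \<alpha> the descents are exactly the boundaries, so every descent set is
  realised.\<close>

fun descent_word :: "nat list \<Rightarrow> nat list" where
  "descent_word [] = []"
| "descent_word (a # \<alpha>) = [Suc (sum_list \<alpha>)..<Suc (sum_list \<alpha> + a)] @ descent_word \<alpha>"

lemma mset_descent_word: "mset (descent_word \<alpha>) = mset [1..<Suc (sum_list \<alpha>)]"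
proof (induction \<alpha>)
  case (Cons a \<alpha>)
  have "[1..<Suc (sum_list (a # \<alpha>))] = [1..<Suc (sum_list \<alpha>)] @ [Suc (sum_list \<alpha>)..<Suc (sum_list \<alpha> + a)]"
    using upt_add_eq_append[of 1 "Suc (sum_list \<alpha>)" a] by (simp add: add.commute del: upt_Suc)
  then show ?case using Cons by (simp add: union_commute del: upt_Suc)
qed simp

lemma descents_descent_word: "\<alpha> \<in> compositions \<Longrightarrow> descents (descent_word \<alpha>) = psums \<alpha>"
proof (induction \<alpha>)
  case (Cons a \<alpha>)
  let ?N = "sum_list \<alpha>"
  let ?w = "descent_word (a # \<alpha>)"
  have a: "0 < a" and \<alpha>: "\<alpha> \<in> compositions" using Cons.prems by (auto simp: compositions_def)
  have len: "length (descent_word \<alpha>) = ?N" using arg_cong[OF mset_descent_word[of \<alpha>], of size] by (simp del: upt_Suc)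
  have low: "?w ! i = Suc ?N + i" if "i < a" for i using that by (simp add: nth_append del: upt_Suc)
  have high: "?w ! (a + i) = descent_word \<alpha> ! i" for i by (simp add: nth_append del: upt_Suc)
  have small: "descent_word \<alpha> ! i \<le> ?N" if "i < ?N" for i
  proof -
    have "descent_word \<alpha> ! i \<in> set (descent_word \<alpha>)" using that len by simp
    then show ?thesis using arg_cong[OF mset_descent_word[of \<alpha>], of set_mset] by (auto simp del: upt_Suc)
  qed
  show ?case
  proof (cases "\<alpha> = []")
    case True
    then show ?thesis by (auto simp: descents_def simp del: upt_Suc)
  next
    case False
    have "0 < ?N" using False \<alpha> by (cases \<alpha>) (auto simp: compositions_def)
    have "descents ?w = insert a ((+) a ` descents (descent_word \<alpha>))"
    proof (rule set_eqI)
      fix i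
      consider "i < a" | "i = a" | "i > a" by linarith
      then show "i \<in> descents ?w \<longleftrightarrow> i \<in> insert a ((+) a ` descents (descent_word \<alpha>))"
      proof cases
        case 1
        then show ?thesis using low[of i] low[of "i - 1"] by (auto simp: descents_def simp del: descent_word.simps)
      next
        case 2
        have "?w ! a < ?w ! (a - 1)" using low[of "a - 1"] high[of 0] small[of 0] \<open>0 < ?N\<close> a by simp
        then show ?thesis using 2 a \<open>0 < ?N\<close> len by (simp add: descents_def del: upt_Suc)
      next
        case 3
        then obtain j where j: "i = a + Suc j" using less_iff_Suc_add[of a i] by auto
        have "i \<in> descents ?w \<longleftrightarrow> Suc j \<in> descents (descent_word \<alpha>)"
          using high[of j] high[of "Suc j"] len by (simp add: j descents_def del: upt_Suc descent_word.simps) (simp del: upt_Suc)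
        then show ?thesis using j by auto
      qed
    qed
    then show ?thesis using Cons.IH[OF \<alpha>] by (simp add: psums_Cons[OF False])
  qed
qed (simp add: descents_def)

text \<open>At a permutation with descent set \<open>psums \<alpha>\<close>, the value of
  \<open>X n \<beta>\<close> is 1 or 0 according to whether \<open>psums \<alpha>\<close> is
  contained in \<open>psums \<beta>\<close>. This is unitriangular for inclusion, with the number of
  partial sums as rank.\<close>

lemma X_basis: "inj_on (X n) (Comp n)" "rvs.independent (X n ` Comp n)"
proof -
  have ex: "\<exists>\<sigma>. \<sigma> permutes {1..n} \<and> descents (word n \<sigma>) = psums \<alpha>" if \<alpha>: "\<alpha> \<in> Comp n" for \<alpha>
  proof -
    have "mset (descent_word \<alpha>) = mset [1..<Suc n]" using \<alpha> mset_descent_word[of \<alpha>] by (simp add: Comp_def)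
    then obtain \<sigma> where "\<sigma> permutes {1..n}" "word n \<sigma> = descent_word \<alpha>" by (rule word_surj)
    then show ?thesis using descents_descent_word[of \<alpha>] \<alpha> by (auto simp: Comp_def)
  qed
  define p where "p \<alpha> = (SOME \<sigma>. \<sigma> permutes {1..n} \<and> descents (word n \<sigma>) = psums \<alpha>)" for \<alpha>
  have p: "p \<alpha> permutes {1..n}" "descents (word n (p \<alpha>)) = psums \<alpha>" if "\<alpha> \<in> Comp n" for \<alpha>
    using someI_ex[OF ex[OF that]] by (auto simp: p_def)
  have Xp: "X n \<beta> (p \<alpha>) = (if psums \<alpha> \<subseteq> psums \<beta> then 1 else 0)" if "\<alpha> \<in> Comp n" "\<beta> \<in> Comp n" for \<alpha> \<beta>
    using that p[OF that(1)] block_sorted_descents[of \<beta> "word n (p \<alpha>)"] by (simp add: X_eq distinct_word)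
  have diag: "X n \<alpha> (p \<alpha>) \<noteq> 0" if "\<alpha> \<in> Comp n" for \<alpha> using Xp that by simp
  have tri: "int (card (psums \<alpha>)) < int (card (psums \<beta>))"
    if "\<alpha> \<in> Comp n" "\<beta> \<in> Comp n" "\<alpha> \<noteq> \<beta>" "X n \<beta> (p \<alpha>) \<noteq> 0" for \<alpha> \<beta>
  proof -
    have "psums \<alpha> \<subseteq> psums \<beta>" using Xp[OF that(1,2)] that(4) by (auto split: if_splits)
    moreover have "psums \<alpha> \<noteq> psums \<beta>" using psums_inj that by blast
    moreover have "finite (psums \<beta>)" using psums_subset[OF that(2)] finite_subset by blast
    ultimately show ?thesis by (simp add: psubset_card_mono psubset_eq)
  qed
  show "inj_on (X n) (Comp n)" by (rule triangular_independent(1)[where p = p]) (fact diag tri)+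
  show "rvs.independent (X n ` Comp n)" by (rule triangular_independent(2)[where p = p]) (fact diag tri)+
qed

lemma strict_sorted_nth_less_iff:
  assumes "sorted_wrt (<) (L :: 'a :: linorder list)" "i < length L" "j < length L"
  shows "L ! i < L ! j \<longleftrightarrow> i < j"
  using assms unfolding sorted_wrt_iff_nth_less by (metis less_asym' linorder_neqE_nat)

text \<open>The bijection behind the product rule: a pair \<open>(\<sigma>, \<tau>)\<close> with \<open>\<sigma> \<circ> \<tau> = \<rho>\<close> corresponds to
  the labelling of \<open>\<rho>\<close> that gives the value \<open>\<sigma> j\<close> the number of the \<open>\<beta>\<close>-block containing \<open>j\<close>.\<close>

lemma X_mult_X:
  assumes \<alpha>: "\<alpha> \<in> Comp n" and \<beta>: "\<beta> \<in> Comp n" and \<rho>: "\<rho> permutes {1..n}"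
  shows "galg_mult n (X n \<beta>) (X n \<alpha>) \<rho> = labellings (word n \<rho>) \<alpha> (pack \<beta>)"
proof -
  let ?b = "block_word 0 \<beta>"
  define P where "P = {(\<sigma>, \<tau>). \<sigma> permutes {1..n} \<and> \<tau> permutes {1..n} \<and> \<sigma> \<circ> \<tau> = \<rho>}"
  define Q where "Q = {p \<in> P. block_sorted (<) (word n (fst p)) \<beta> \<and> block_sorted (<) (word n (snd p)) \<alpha>}"
  define h where "h p = map (\<lambda>j. ?b ! (j - 1)) (word n (snd p))" for p :: "(nat \<Rightarrow> nat) \<times> (nat \<Rightarrow> nat)"
  have sl: "sum_list \<beta> = n" using \<beta> by (simp add: Comp_def)
  \<comment> \<open>Since \<rho> i = \<sigma> (\<tau> i), the labelled letters of \<rho> are those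
    of \<sigma> read in the order \<tau>. When the latter increase strictly, comparing labelled
    letters of \<rho> amounts to comparing entries of \<tau>.\<close>
  have zip_h: "zip (h (\<sigma>, \<tau>)) (word n \<rho>) = map (\<lambda>j. zip ?b (word n \<sigma>) ! (j - 1)) (word n \<tau>)"
    if "\<tau> permutes {1..n}" "\<sigma> \<circ> \<tau> = \<rho>" for \<sigma> \<tau>
  proof (rule nth_equalityI)
    fix i assume "i < length (zip (h (\<sigma>, \<tau>)) (word n \<rho>))"
    then have i: "i < n" by (simp add: h_def)
    have t: "\<tau> (Suc i) \<in> {1..n}" using permutes_in_image[OF that(1), of "Suc i"] i by simp
    have "\<rho> (Suc i) = \<sigma> (\<tau> (Suc i))" using that(2) by auto
    then show "zip (h (\<sigma>, \<tau>)) (word n \<rho>) ! i = map (\<lambda>j. zip ?b (word n \<sigma>) ! (j - 1)) (word n \<tau>) ! i"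
      using i t sl by (auto simp: h_def nth_word)
  qed (simp add: h_def)
  have mset_h: "mset (h (\<sigma>, \<tau>)) = mset ?b" if "\<tau> permutes {1..n}" for \<sigma> \<tau>
  proof -
    have "mset (h (\<sigma>, \<tau>)) = image_mset (\<lambda>j. ?b ! (j - 1)) (mset [1..<Suc n])"
      by (simp add: h_def mset_word[OF that] del: upt_Suc)
    also have "\<dots> = mset (map (\<lambda>j. ?b ! (j - 1)) [1..<Suc n])" by (simp del: upt_Suc)
    also have "map (\<lambda>j. ?b ! (j - 1)) [1..<Suc n] = ?b"
      by (rule nth_equalityI) (auto simp: sl nth_append simp del: upt_Suc)
    finally show ?thesis .
  qed
  have sorted_iff: "block_sorted (<) (zip (h (\<sigma>, \<tau>)) (word n \<rho>)) \<alpha> \<longleftrightarrow> block_sorted (<) (word n \<tau>) \<alpha>"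
    if "\<tau> permutes {1..n}" "\<sigma> \<circ> \<tau> = \<rho>" "sorted_wrt (<) (zip ?b (word n \<sigma>))" for \<sigma> \<tau>
    unfolding zip_h[OF that(1,2)]
  proof (rule block_sorted_map)
    fix x y assume "x \<in> set (word n \<tau>)" "y \<in> set (word n \<tau>)"
    then have "x \<in> {1..n}" "y \<in> {1..n}" using set_word[OF that(1)] by auto
    then show "zip ?b (word n \<sigma>) ! (x - 1) < zip ?b (word n \<sigma>) ! (y - 1) \<longleftrightarrow> x < y"
      using strict_sorted_nth_less_iff[OF that(3), of "x - 1" "y - 1"] sl by auto
  qed
  have \<beta>_iff: "block_sorted (<) (word n \<sigma>) \<beta> \<longleftrightarrow> sorted_wrt (<) (zip ?b (word n \<sigma>))" for \<sigma>
    using sorted_zip_block_word[of "word n \<sigma>" \<beta> 0] sl by simp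
  have set_h: "set (zip (h (\<sigma>, \<tau>)) (word n \<rho>)) = set (zip ?b (word n \<sigma>))" if "\<tau> permutes {1..n}" "\<sigma> \<circ> \<tau> = \<rho>" for \<sigma> \<tau>
  proof -
    have "set (zip (h (\<sigma>, \<tau>)) (word n \<rho>)) = (\<lambda>j. zip ?b (word n \<sigma>) ! (j - 1)) ` {1..n}"
      unfolding zip_h[OF that] using set_word[OF that(1)] by simp
    also have "\<dots> = (\<lambda>j. zip ?b (word n \<sigma>) ! j) ` {0..<n}"
    proof -
      have "{0..<n} = (\<lambda>j. j - 1) ` {1..n}"
        by (auto intro!: image_eqI[of _ _ "Suc _"])
      then show ?thesis by (simp add: image_image)
    qed
    also have "\<dots> = set (zip ?b (word n \<sigma>))"
      using nth_image[of n "zip ?b (word n \<sigma>)"] sl by simp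
    finally show ?thesis .
  qed
  have "bij_betw h Q (labels (word n \<rho>) \<alpha> (pack \<beta>))"
    unfolding bij_betw_def
  proof
    show "inj_on h Q"
    proof (rule inj_onI)
      fix p q assume *: "p \<in> Q" "q \<in> Q" "h p = h q"
      obtain \<sigma> \<tau> \<sigma>' \<tau>' where pq: "p = (\<sigma>, \<tau>)" "q = (\<sigma>', \<tau>')" by (cases p, cases q)
      have perms: "\<sigma> permutes {1..n}" "\<tau> permutes {1..n}" "\<sigma> \<circ> \<tau> = \<rho>" "block_sorted (<) (word n \<sigma>) \<beta>"
        "\<sigma>' permutes {1..n}" "\<tau>' permutes {1..n}" "\<sigma>' \<circ> \<tau>' = \<rho>" "block_sorted (<) (word n \<sigma>') \<beta>"
        using *(1,2) unfolding pq Q_def P_def by auto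
      \<comment> \<open>The set of labelled letters determines \<sigma>: there is only one way to
        list it in increasing order. Then \<tau> is determined by cancelling \<sigma>.\<close>
      have "set (zip ?b (word n \<sigma>)) = set (zip ?b (word n \<sigma>'))"
        using set_h[OF perms(2,3)] set_h[OF perms(6,7)] *(3) pq by simp
      then have "zip ?b (word n \<sigma>) = zip ?b (word n \<sigma>')"
        using perms(4,8) unfolding \<beta>_iff by (intro strict_sorted_equal)
      then have "map snd (zip ?b (word n \<sigma>)) = map snd (zip ?b (word n \<sigma>'))" by simp
      then have "word n \<sigma> = word n \<sigma>'" using sl by simp
      then have \<sigma>: "\<sigma> = \<sigma>'" by (rule word_inj[OF perms(1,5)])
      moreover have "\<tau> = \<tau>'"
      proof
        fix i have "\<sigma> (\<tau> i) = \<sigma> (\<tau>' i)" using fun_cong[OF perms(3), of i] fun_cong[OF perms(7), of i] \<sigma> by simp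
        then show "\<tau> i = \<tau>' i" by (rule injD[OF permutes_inj[OF perms(1)]])
      qed
      ultimately show "p = q" using pq by simp
    qed
    show "h ` Q = labels (word n \<rho>) \<alpha> (pack \<beta>)"
    proof
      show "h ` Q \<subseteq> labels (word n \<rho>) \<alpha> (pack \<beta>)"
        using mset_h sorted_iff \<beta>_iff
        by (fastforce simp: labels_def Q_def P_def cont_eq_pack h_def)
      show "labels (word n \<rho>) \<alpha> (pack \<beta>) \<subseteq> h ` Q"
      proof
        fix g assume "g \<in> labels (word n \<rho>) \<alpha> (pack \<beta>)"
        then have g: "length g = n" "mset g = mset ?b" "block_sorted (<) (zip g (word n \<rho>)) \<alpha>"
          by (auto simp: labels_def cont_eq_pack)
        \<comment> \<open>The inverse construction: sort the labelled letters lexicographically.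
          Their labels then spell the block word, their letters spell \<sigma>, and \<tau> is what
          remains of \<rho>.\<close>
        define L where "L = sort (zip g (word n \<rho>))"
        have dz: "distinct (zip g (word n \<rho>))" using distinct_word[OF \<rho>] by (rule distinct_zipI2)
        then have Ls: "sorted_wrt (<) L" "length L = n" by (simp_all add: L_def strict_sorted_iff g)
        have mL: "mset L = mset (zip g (word n \<rho>))" by (simp add: L_def)
        have "mset (map fst L) = mset g" using mL g by (metis length_word map_fst_zip mset_map)
        moreover have "sorted (map fst L)"
          unfolding sorted_iff_nth_mono_less
        proof (intro allI impI)
          fix i j assume "i < j" "j < length (map fst L)"
          then have "L ! i < L ! j" using Ls(1) by (simp add: sorted_wrt_iff_nth_less)
          then show "map fst L ! i \<le> map fst L ! j" using \<open>i < j\<close> \<open>j < length (map fst L)\<close>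
            by (auto simp: less_prod_def')
        qed
        ultimately have fstL: "map fst L = ?b"
          using g(2) sorted_block_word properties_for_sort by metis
        have "mset (map snd L) = mset (word n \<rho>)" using mL g by (metis length_word map_snd_zip mset_map)
        also have "\<dots> = mset [1..<Suc n]" by (rule mset_word[OF \<rho>])
        finally obtain \<sigma> where \<sigma>: "\<sigma> permutes {1..n}" "word n \<sigma> = map snd L" by (rule word_surj)
        have L: "L = zip ?b (word n \<sigma>)" unfolding \<sigma>(2) fstL[symmetric] by (rule zip_map_fst_snd[symmetric])
        define \<tau> where "\<tau> = inv \<sigma> \<circ> \<rho>"
        have \<tau>: "\<tau> permutes {1..n}" unfolding \<tau>_def by (intro permutes_compose \<rho> permutes_inv \<sigma>(1))
        have comp: "\<sigma> \<circ> \<tau> = \<rho>" unfolding \<tau>_def by (simp add: o_assoc permutes_inv_o[OF \<sigma>(1)])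
        have hg: "h (\<sigma>, \<tau>) = g"
        proof (rule nth_equalityI)
          fix i assume "i < length (h (\<sigma>, \<tau>))"
          then have i: "i < n" by (simp add: h_def)
          have "(g ! i, \<rho> (Suc i)) \<in> set (zip g (word n \<rho>))"
            using i g(1) nth_word[OF i, of \<rho>] by (metis length_word length_zip min.idem nth_mem nth_zip)
          then have "(g ! i, \<rho> (Suc i)) \<in> set L" using mL by (metis set_mset_mset)
          then obtain j where j: "j < n" "L ! j = (g ! i, \<rho> (Suc i))" using Ls(2) by (auto simp: in_set_conv_nth)
          then have "?b ! j = g ! i" "\<sigma> (Suc j) = \<rho> (Suc i)" using sl by (simp_all add: L nth_word)
          moreover from this have "\<tau> (Suc i) = Suc j" using permutes_inv_eq[OF \<sigma>(1)] by (simp add: \<tau>_def)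
          ultimately show "h (\<sigma>, \<tau>) ! i = g ! i" using i by (simp add: h_def nth_word)
        qed (simp add: h_def g)
        have "(\<sigma>, \<tau>) \<in> Q"
          using \<sigma>(1) \<tau> comp Ls(1) sorted_iff[OF \<tau> comp] g(3) hg \<beta>_iff by (simp add: Q_def P_def L)
        then show "g \<in> h ` Q" using hg by (metis imageI)
      qed
    qed
  qed
  then have "card Q = card (labels (word n \<rho>) \<alpha> (pack \<beta>))" by (rule bij_betw_same_card)
  moreover have "galg_mult n (X n \<beta>) (X n \<alpha>) \<rho> = of_nat (card Q)"
  proof -
    have "finite P"
    proof (rule finite_subset)
      show "P \<subseteq> {\<sigma>. \<sigma> permutes {1..n}} \<times> {\<sigma>. \<sigma> permutes {1..n}}" by (auto simp: P_def)
    qed (simp add: finite_permutations)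
    have "galg_mult n (X n \<beta>) (X n \<alpha>) \<rho> = (\<Sum>p\<in>P. if p \<in> Q then 1 else 0)"
      unfolding galg_mult_def P_def[symmetric]
      by (rule sum.cong) (auto simp: X_eq \<alpha> \<beta> Q_def P_def)
    also have "\<dots> = of_nat (card (P \<inter> Q))" using \<open>finite P\<close> by (simp add: sum.If_cases)
    also have "P \<inter> Q = Q" by (auto simp: Q_def)
    finally show ?thesis .
  qed
  ultimately show ?thesis by (simp add: labellings_def)
qed

section \<open>The matrix of a Hopf endomorphism\<close>

definition splits :: "'a list \<Rightarrow> ('a list \<times> 'a list) set" where
  "splits \<alpha> = {(\<beta>, \<gamma>). \<beta> @ \<gamma> = \<alpha>}"

lemma finite_splits_list: "finite (splits \<alpha>)"
proof (rule finite_subset)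
  show "splits \<alpha> \<subseteq> (\<lambda>k. (take k \<alpha>, drop k \<alpha>)) ` {..length \<alpha>}"
  proof
    fix p assume "p \<in> splits \<alpha>"
    then have "p = (take (length (fst p)) \<alpha>, drop (length (fst p)) \<alpha>)" "length (fst p) \<le> length \<alpha>"
      by (auto simp: splits_def)
    then show "p \<in> (\<lambda>k. (take k \<alpha>, drop k \<alpha>)) ` {..length \<alpha>}" by blast
  qed
qed simp

lemma splits_compositions: "\<alpha> \<in> compositions \<Longrightarrow> (\<beta>, \<gamma>) \<in> splits \<alpha> \<Longrightarrow> \<beta> \<in> compositions \<and> \<gamma> \<in> compositions"
  by (auto simp: splits_def compositions_def)

text \<open>A composition of a + b need not have a as a partial sum. The vanishing hypothesis
  removes every split at another place, and what remains is in bijection with pairs by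
  concatenation.\<close>

lemma sum_splits:
  fixes h :: "nat list \<Rightarrow> nat list \<Rightarrow> rat"
  assumes zero: "\<And>\<beta> \<gamma>. \<beta> \<in> compositions \<Longrightarrow> \<beta> \<notin> Comp a \<Longrightarrow> h \<beta> \<gamma> = 0"
  shows "(\<Sum>\<alpha>\<in>Comp (a + b). \<Sum>(\<beta>, \<gamma>)\<in>splits \<alpha>. h \<beta> \<gamma>) = (\<Sum>\<beta>\<in>Comp a. \<Sum>\<gamma>\<in>Comp b. h \<beta> \<gamma>)"
proof -
  let ?S = "Sigma (Comp (a + b)) splits"
  let ?f = "\<lambda>(\<beta>, \<gamma>). (\<beta> @ \<gamma>, (\<beta>, \<gamma>)) :: nat list \<times> nat list \<times> nat list"
  have "(\<Sum>\<alpha>\<in>Comp (a + b). \<Sum>(\<beta>, \<gamma>)\<in>splits \<alpha>. h \<beta> \<gamma>) = (\<Sum>(\<alpha>, \<beta>, \<gamma>)\<in>?S. h \<beta> \<gamma>)"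
    by (subst sum.Sigma) (auto simp: finite_Comp finite_splits_list)
  also have "\<dots> = (\<Sum>(\<alpha>, \<beta>, \<gamma>)\<in>?f ` (Comp a \<times> Comp b). h \<beta> \<gamma>)"
  proof (rule sum.mono_neutral_right)
    show "finite ?S" by (intro finite_SigmaI finite_Comp finite_splits_list)
    show "?f ` (Comp a \<times> Comp b) \<subseteq> ?S" by (auto simp: splits_def append_in_Comp)
    show "\<forall>x\<in>?S - ?f ` (Comp a \<times> Comp b). (case x of (\<alpha>, \<beta>, \<gamma>) \<Rightarrow> h \<beta> \<gamma>) = 0"
    proof (rule ballI)
      fix x assume x: "x \<in> ?S - ?f ` (Comp a \<times> Comp b)"
      obtain \<beta> \<gamma> where x': "x = (\<beta> @ \<gamma>, \<beta>, \<gamma>)" "\<beta> @ \<gamma> \<in> Comp (a + b)" using x by (auto simp: splits_def)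
      have "\<gamma> \<in> Comp b" if "\<beta> \<in> Comp a" using that x'(2) by (auto simp: Comp_def compositions_def)
      then have "\<beta> \<notin> Comp a" using x x' by auto
      moreover have "\<beta> \<in> compositions" using x'(2) by (auto simp: Comp_def compositions_def)
      ultimately show "(case x of (\<alpha>, \<beta>, \<gamma>) \<Rightarrow> h \<beta> \<gamma>) = 0" using zero x' by simp
    qed
  qed
  also have "\<dots> = (\<Sum>(\<beta>, \<gamma>)\<in>Comp a \<times> Comp b. h \<beta> \<gamma>)"
    by (subst sum.reindex) (auto simp: inj_on_def intro!: sum.cong)
  also have "\<dots> = (\<Sum>\<beta>\<in>Comp a. \<Sum>\<gamma>\<in>Comp b. h \<beta> \<gamma>)"
    by (rule sum.cartesian_product[symmetric])
  finally show ?thesis .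
qed

text \<open>Since a is positive, \<open>[a]\<close> is the only prefix of
  \<open>a # \<alpha>\<close> with sum a. This isolates diagonal entries and leading
  coefficients.\<close>

lemma sum_splits_Comp:
  fixes h :: "nat list \<Rightarrow> nat list \<Rightarrow> rat"
  assumes \<alpha>: "a # \<alpha> \<in> compositions" 
    and zero: "\<And>\<beta> \<gamma>. \<beta> \<in> compositions \<Longrightarrow> \<beta> \<notin> Comp a \<Longrightarrow> h \<beta> \<gamma> = 0"
  shows "(\<Sum>(\<beta>, \<gamma>)\<in>splits (a # \<alpha>). h \<beta> \<gamma>) = h [a] \<alpha>"
proof -
  have "(\<Sum>(\<beta>, \<gamma>)\<in>splits (a # \<alpha>). h \<beta> \<gamma>) = (\<Sum>(\<beta>, \<gamma>)\<in>{([a], \<alpha>)}. h \<beta> \<gamma>)"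
  proof (rule sum.mono_neutral_right[OF finite_splits_list])
    show "\<forall>p\<in>splits (a # \<alpha>) - {([a], \<alpha>)}. (case p of (\<beta>, \<gamma>) \<Rightarrow> h \<beta> \<gamma>) = 0"
    proof (rule ballI)
      fix p assume p: "p \<in> splits (a # \<alpha>) - {([a], \<alpha>)}"
      obtain \<beta> \<gamma> where bg: "p = (\<beta>, \<gamma>)" by (cases p)
      then have sp: "(\<beta>, \<gamma>) \<in> splits (a # \<alpha>)" and ne: "(\<beta>, \<gamma>) \<noteq> ([a], \<alpha>)" using p by auto
      have c: "\<beta> \<in> compositions" using splits_compositions[OF \<alpha> sp] by simp
      have "\<beta> \<notin> Comp a"
      proof
        assume "\<beta> \<in> Comp a"
        moreover have "a > 0" using \<alpha> by (auto simp: compositions_def)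
        ultimately obtain \<beta>' where b: "\<beta> = a # \<beta>'" using sp by (cases \<beta>) (auto simp: splits_def)
        then have "\<beta>' \<in> Comp 0" using \<open>\<beta> \<in> Comp a\<close> by (simp add: Cons_in_Comp)
        then show False using ne sp b by (auto simp: Comp_0 splits_def)
      qed
      then show "(case p of (\<beta>, \<gamma>) \<Rightarrow> h \<beta> \<gamma>) = 0" using zero[OF c] bg by simp
    qed
  qed (auto simp: splits_def)
  then show ?thesis by simp
qed

section \<open>The coproduct and evaluation at (1,0,0,...) in coordinates\<close>

lemma tensor_pack: "\<beta> \<in> compositions \<Longrightarrow> \<gamma> \<in> compositions \<Longrightarrow> \<beta>' \<in> compositions \<Longrightarrow> \<gamma>' \<in> compositions \<Longrightarrow>
  tensor (M \<beta>') (M \<gamma>') (pack \<beta>, pack \<gamma>) = (if (\<beta>', \<gamma>') = (\<beta>, \<gamma>) then 1 else 0)"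
  by (auto simp: tensor_def M_pack)

abbreviation "comp_pairs \<equiv> compositions \<times> compositions"

lemma tensor_basis:
  "inj_on (\<lambda>(\<beta>, \<gamma>). tensor (M \<beta>) (M \<gamma>)) comp_pairs"
  "rvs.independent ((\<lambda>(\<beta>, \<gamma>). tensor (M \<beta>) (M \<gamma>)) ` comp_pairs)"
  by (rule triangular_independent[where p = "\<lambda>(\<beta>, \<gamma>). (pack \<beta>, pack \<gamma>)" and r = "\<lambda>_. 0"];
      auto simp: tensor_pack split: if_splits)+

lemma M_coeff2_eq:
  assumes "t \<in> rvs.span ((\<lambda>(\<beta>, \<gamma>). tensor (M \<beta>) (M \<gamma>)) ` comp_pairs)" "\<beta> \<in> compositions" "\<gamma> \<in> compositions"
  shows "M_coeff2 t (\<beta>, \<gamma>) = t (pack \<beta>, pack \<gamma>)"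
proof -
  have "{tensor (M \<beta>) (M \<gamma>) |\<beta> \<gamma>. \<beta> \<in> compositions \<and> \<gamma> \<in> compositions} =
      (\<lambda>(\<beta>, \<gamma>). tensor (M \<beta>) (M \<gamma>)) ` comp_pairs" by auto
  then show ?thesis
    using representation_eval[OF tensor_basis assms(1), of "\<lambda>(\<beta>, \<gamma>). (pack \<beta>, pack \<gamma>)" "(\<beta>, \<gamma>)"] assms(2,3)
    by (auto simp: M_coeff2_def tensor_pack)
qed

text \<open>Deconcatenation is dual to concatenation: the tensor of \<open>M \<beta>\<close> and
  \<open>M \<gamma>\<close> occurs in the coproduct of \<open>M \<alpha>\<close> only for \<alpha> =
  \<open>\<beta> @ \<gamma>\<close>, and then once.\<close>

lemma coproduct_pack:
  assumes f: "f \<in> QSym" and \<beta>: "\<beta> \<in> compositions" and \<gamma>: "\<gamma> \<in> compositions"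
  shows "coproduct f (pack \<beta>, pack \<gamma>) = f (pack (\<beta> @ \<gamma>))"
proof -
  let ?S = "{\<alpha> \<in> compositions. M_coeff f \<alpha> \<noteq> 0}"
  have S: "?S = {\<alpha> \<in> compositions. f (pack \<alpha>) \<noteq> 0}" using M_coeff_eq[OF f] by auto
  have fin: "finite ?S" unfolding S by (rule finite_M_coeff[OF f])
  have inner: "(\<Sum>(\<beta>', \<gamma>')\<in>splits \<alpha>. tensor (M \<beta>') (M \<gamma>')) (pack \<beta>, pack \<gamma>) = (if \<alpha> = \<beta> @ \<gamma> then 1 else 0)"
    if \<alpha>: "\<alpha> \<in> compositions" for \<alpha>
  proof -
    have "(\<Sum>(\<beta>', \<gamma>')\<in>splits \<alpha>. tensor (M \<beta>') (M \<gamma>')) (pack \<beta>, pack \<gamma>) =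
        (\<Sum>p\<in>splits \<alpha>. if p = (\<beta>, \<gamma>) then 1 else 0)"
      unfolding sum_fun_apply
    proof (rule sum.cong[OF refl])
      fix p assume p: "p \<in> splits \<alpha>"
      obtain \<beta>' \<gamma>' where bg: "p = (\<beta>', \<gamma>')" by (cases p)
      show "(case p of (\<beta>', \<gamma>') \<Rightarrow> tensor (M \<beta>') (M \<gamma>')) (pack \<beta>, pack \<gamma>) = (if p = (\<beta>, \<gamma>) then 1 else 0)"
        using tensor_pack[OF \<beta> \<gamma>, of \<beta>' \<gamma>'] splits_compositions[OF \<alpha>, of \<beta>' \<gamma>'] p bg by simp
    qed
    also have "\<dots> = (if \<alpha> = \<beta> @ \<gamma> then 1 else 0)" using finite_splits_list[of \<alpha>] by (auto simp: splits_def)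
    finally show ?thesis .
  qed
  have "coproduct f (pack \<beta>, pack \<gamma>) =
      (\<Sum>\<alpha>\<in>?S. M_coeff f \<alpha> * (\<Sum>(\<beta>', \<gamma>')\<in>splits \<alpha>. tensor (M \<beta>') (M \<gamma>')) (pack \<beta>, pack \<gamma>))"
    unfolding coproduct_def splits_def sum_fun_apply[where A = ?S] scale_apply ..
  also have "\<dots> = (\<Sum>\<alpha>\<in>?S. f (pack \<alpha>) * (if \<alpha> = \<beta> @ \<gamma> then 1 else 0))"
    by (intro sum.cong[OF refl] arg_cong2[where f = "(*)"]) (use inner M_coeff_eq[OF f] in blast)+
  also have "\<dots> = (\<Sum>\<alpha>\<in>?S. if \<alpha> = \<beta> @ \<gamma> then f (pack (\<beta> @ \<gamma>)) else 0)"
    by (rule sum.cong) auto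
  also have "\<dots> = f (pack (\<beta> @ \<gamma>))"
  proof -
    have "\<beta> @ \<gamma> \<in> compositions" using \<beta> \<gamma> by (auto simp: compositions_def)
    then show ?thesis using fin M_coeff_eq[OF f, of "\<beta> @ \<gamma>"] by auto
  qed
  finally show ?thesis .
qed

lemma coproduct_M:
  assumes "\<alpha> \<in> compositions"
  shows "coproduct (M \<alpha>) = (\<Sum>(\<beta>, \<gamma>)\<in>splits \<alpha>. tensor (M \<beta>) (M \<gamma>))"
proof -
  have c: "M_coeff (M \<alpha>) \<beta> = (if \<alpha> = \<beta> then 1 else 0)" if "\<beta> \<in> compositions" for \<beta>
    using M_coeff_eq[OF M_in_QSym[OF assms] that] M_pack[OF assms that] by simp
  have "{\<beta> \<in> compositions. M_coeff (M \<alpha>) \<beta> \<noteq> 0} = {\<alpha>}" using c assms by (auto split: if_splits)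
  then show ?thesis using c[OF assms] by (simp add: coproduct_def splits_def)
qed

lemma coproduct_M_in_span:
  assumes "\<alpha> \<in> compositions"
  shows "coproduct (M \<alpha>) \<in> rvs.span ((\<lambda>(\<beta>, \<gamma>). tensor (M \<beta>) (M \<gamma>)) ` comp_pairs)"
  unfolding coproduct_M[OF assms]
proof (intro rvs.span_sum rvs.span_base)
  fix p assume "p \<in> splits \<alpha>"
  then have "p \<in> comp_pairs" using splits_compositions[OF assms, of "fst p" "snd p"] by (cases p) auto
  then show "(case p of (\<beta>, \<gamma>) \<Rightarrow> tensor (M \<beta>) (M \<gamma>)) \<in> (\<lambda>(\<beta>, \<gamma>). tensor (M \<beta>) (M \<gamma>)) ` comp_pairs"
    by (cases p) auto
qed

lemma M_Nil: "M [] = ps_one"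
proof
  fix m :: monomial
  have "exps m = [] \<longleftrightarrow> m = 0" by (simp add: exps_def)
  then show "M [] m = ps_one m" using M_apply[of "[]" m] by (auto simp: compositions_def ps_one_def)
qed

lemma pack_one_part: "pack (one_part n) = Poly_Mapping.single 0 n"
  by (simp add: pack_def xmono_def one_part_def)

text \<open>The coefficient of \<open>x\<^sub>0\<^sup>n\<close> is the evaluation at \<open>(1, 0, 0, \<dots>)\<close> in degree \<open>n\<close>.\<close>

lemma ps_mult_one_part:
  assumes f: "f \<in> QSym_deg a" and g: "g \<in> QSym_deg b"
  shows "ps_mult f g (pack (one_part (a + b))) = f (pack (one_part a)) * g (pack (one_part b))"
proof -
  let ?s = "Poly_Mapping.single 0 :: nat \<Rightarrow> monomial"
  have f0: "f (?s i) = 0" if "i \<noteq> a" for i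
  proof -
    have "one_part i \<notin> Comp a" using one_part_in_Comp[of i] that by (auto simp: Comp_def)
    then show ?thesis
      using QSym_deg_zero[OF f Comp_compositions[OF one_part_in_Comp[of i]]] by (simp add: pack_one_part)
  qed
  have eq: "u = ?s (Poly_Mapping.lookup u 0)" if "u + v = ?s (a + b)" for u v
  proof (rule poly_mapping_eqI)
    fix x show "Poly_Mapping.lookup u x = Poly_Mapping.lookup (?s (Poly_Mapping.lookup u 0)) x"
      using arg_cong[OF that, of "\<lambda>m. Poly_Mapping.lookup m x"]
      by (cases "x = 0") (auto simp: lookup_add lookup_single)
  qed
  have "ps_mult f g (?s (a + b)) = (\<Sum>(u, v)\<in>{(?s a, ?s b)}. f u * g v)"
    unfolding ps_mult_def
  \<comment> \<open>Only powers of the first variable divide a power of it, and homogeneity of f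
    leaves the exponent a as the only contribution.\<close>
  proof (rule sum.mono_neutral_right[OF finite_splits])
    show "{(?s a, ?s b)} \<subseteq> {(u, v). u + v = ?s (a + b)}" by (simp add: single_add)
    show "\<forall>p\<in>{(u, v). u + v = ?s (a + b)} - {(?s a, ?s b)}. (case p of (u, v) \<Rightarrow> f u * g v) = 0"
    proof (rule ballI)
      fix p assume p: "p \<in> {(u, v). u + v = ?s (a + b)} - {(?s a, ?s b)}"
      obtain u v where puv: "p = (u, v)" by (cases p)
      then have uv: "u + v = ?s (a + b)" "\<not> (u = ?s a \<and> v = ?s b)" using p by auto
      have "Poly_Mapping.lookup u 0 \<noteq> a"
      proof
        assume "Poly_Mapping.lookup u 0 = a"
        then have "u = ?s a" using eq[OF uv(1)] by simp
        moreover from this have "?s a + v = ?s a + ?s b" using uv(1) by (simp add: single_add)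
        then have "v = ?s b" by simp
        ultimately show False using uv(2) by simp
      qed
      then have "f u = 0" using f0 eq[OF uv(1)] by metis
      then show "(case p of (u, v) \<Rightarrow> f u * g v) = 0" using puv by simp
    qed
  qed
  then show ?thesis by (simp add: pack_one_part)
qed

lemma X_coeff_lin_comb: "\<alpha> \<in> Comp n \<Longrightarrow> X_coeff n (lin_comb (Comp n) (X n) c) \<alpha> = c \<alpha>"
proof -
  assume \<alpha>: "\<alpha> \<in> Comp n"
  have sp: "X n \<beta> \<in> rvs.span (X n ` Comp n)" if "\<beta> \<in> Comp n" for \<beta> using that by (intro rvs.span_base) auto
  have "X_coeff n (lin_comb (Comp n) (X n) c) \<alpha> =
      (\<Sum>\<beta>\<in>Comp n. c \<beta> * rvs.representation (X n ` Comp n) (X n \<beta>) (X n \<alpha>))"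
    unfolding X_coeff_def lin_comb_def
    using sp by (simp add: rvs.representation_sum[OF X_basis(2)] rvs.representation_scale[OF X_basis(2)] rvs.span_scale)
  also have "\<dots> = (\<Sum>\<beta>\<in>Comp n. if \<beta> = \<alpha> then c \<alpha> else 0)"
  proof (rule sum.cong[OF refl])
    fix \<beta> assume \<beta>: "\<beta> \<in> Comp n"
    have "rvs.representation (X n ` Comp n) (X n \<beta>) (X n \<alpha>) = (if \<alpha> = \<beta> then 1 else 0)"
      using rvs.representation_basis[OF X_basis(2), of "X n \<beta>" n] \<beta> \<alpha> X_basis(1)[of n] by (simp add: inj_on_eq_iff)
    then show "c \<beta> * rvs.representation (X n ` Comp n) (X n \<beta>) (X n \<alpha>) = (if \<beta> = \<alpha> then c \<alpha> else 0)" by auto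
  qed
  also have "\<dots> = c \<alpha>" using \<alpha> finite_Comp[of n] by simp
  finally show ?thesis .
qed

lemma pairing_lin_comb:
  assumes "G \<in> QSym_deg n"
  shows "pairing n (lin_comb (Comp n) (X n) c) G = (\<Sum>\<alpha>\<in>Comp n. c \<alpha> * G (pack \<alpha>))"
  unfolding pairing_def
  using M_coeff_eq[OF subsetD[OF QSym_deg_subset assms]]
  by (intro sum.cong) (auto simp: X_coeff_lin_comb Comp_compositions)

lemma X_as_lin_comb: "\<alpha> \<in> Comp n \<Longrightarrow> X n \<alpha> = lin_comb (Comp n) (X n) (unitv \<alpha>)"
proof -
  assume "\<alpha> \<in> Comp n"
  moreover have "lin_comb (Comp n) (X n) (unitv \<alpha>) = (\<Sum>\<beta>\<in>Comp n. if \<beta> = \<alpha> then X n \<alpha> else 0)"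
    unfolding lin_comb_def by (intro sum.cong) (auto simp: unitv_def)
  ultimately show ?thesis using finite_Comp[of n] by simp
qed

section \<open>Multiplicativity and triangularity of the matrix of \<Phi>\<close>

context
  fixes \<Phi> :: "pseries \<Rightarrow> pseries"
  assumes hopf: "hopf_endo \<Phi>"
begin

text \<open>The source index comes first. Hence \<open>mat_op\<close> applied to \<open>coef\<close>
  itself is the operator T, while the matrix of \<Phi> has the arguments swapped.\<close>

definition coef :: "nat list \<Rightarrow> nat list \<Rightarrow> rat" where
  "coef \<alpha> \<beta> = \<Phi> (M \<alpha>) (pack \<beta>)"

lemma \<Phi>_in_QSym_deg: "f \<in> QSym_deg n \<Longrightarrow> \<Phi> f \<in> QSym_deg n"
  using hopf unfolding hopf_endo_def by blast

lemma \<Phi>_in_QSym: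
  assumes "\<alpha> \<in> compositions" shows "\<Phi> (M \<alpha>) \<in> QSym_deg (sum_list \<alpha>)" "\<Phi> (M \<alpha>) \<in> QSym"
  using \<Phi>_in_QSym_deg[OF M_in_QSym_deg, of \<alpha> "sum_list \<alpha>"] assms QSym_deg_subset by (auto simp: Comp_def)

lemma coef_zero:
  assumes "\<alpha> \<in> compositions" "\<beta> \<in> compositions" "sum_list \<alpha> \<noteq> sum_list \<beta>"
  shows "coef \<alpha> \<beta> = 0"
  using QSym_deg_zero[OF \<Phi>_in_QSym(1)[OF assms(1)] assms(2)] assms(3) by (auto simp: coef_def Comp_def)

lemma \<Phi>_sum:
  assumes "finite I" "\<And>i. i \<in> I \<Longrightarrow> v i \<in> QSym"
  shows "\<Phi> (lin_comb I v c) = lin_comb I (\<lambda>i. \<Phi> (v i)) c"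
proof -
  have add: "\<Phi> (f + g) = \<Phi> f + \<Phi> g" if "f \<in> QSym" "g \<in> QSym" for f g
    using hopf that by (auto simp: hopf_endo_def)
  have sc: "\<Phi> (scale r f) = scale r (\<Phi> f)" if "f \<in> QSym" for r f
    using hopf that by (auto simp: hopf_endo_def)
  have sub: "rvs.subspace QSym" unfolding QSym_eq by (rule rvs.subspace_span)
  have zero: "\<Phi> 0 = 0" using sc[of 0 0] rvs.subspace_0[OF sub] by simp
  show ?thesis
    using assms unfolding lin_comb_def
  proof (induction I rule: finite_induct)
    case (insert i I)
    have "(\<Sum>j\<in>I. scale (c j) (v j)) \<in> QSym" "scale (c i) (v i) \<in> QSym"
      using insert.prems by (auto intro!: rvs.subspace_sum[OF sub] rvs.subspace_scale[OF sub])
    moreover have "\<Phi> (scale (c i) (v i)) = scale (c i) (\<Phi> (v i))" using insert.prems by (intro sc) simp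
    moreover have "\<Phi> (\<Sum>j\<in>I. scale (c j) (v j)) = (\<Sum>j\<in>I. scale (c j) (\<Phi> (v j)))"
      using insert.prems by (intro insert.IH) simp
    ultimately show ?case
      using add[of "scale (c i) (v i)" "\<Sum>j\<in>I. scale (c j) (v j)"] by (simp only: sum.insert[OF insert.hyps])
  qed (simp add: zero)
qed

lemma \<Phi>_matrix: "\<Phi> (lin_comb (Comp n) M c) = lin_comb (Comp n) M (mat_op (Comp n) (\<lambda>\<beta> \<alpha>. coef \<alpha> \<beta>) c)"
proof -
  have "\<Phi> (lin_comb (Comp n) M c) = lin_comb (Comp n) (\<lambda>\<alpha>. \<Phi> (M \<alpha>)) c"
    by (rule \<Phi>_sum[OF finite_Comp]) (auto intro: M_in_QSym Comp_compositions)
  also have "\<dots> = lin_comb (Comp n) (\<lambda>\<alpha>. lin_comb (Comp n) M (coef \<alpha>)) c"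
    unfolding lin_comb_def[of _ _ c]
    by (intro sum.cong refl arg_cong[where f = "scale _"])
       (use QSym_deg_expand[OF \<Phi>_in_QSym_deg[OF M_in_QSym_deg]] in \<open>simp add: coef_def[abs_def]\<close>)
  also have "\<dots> = lin_comb (Comp n) M (mat_op (Comp n) (\<lambda>\<beta> \<alpha>. coef \<alpha> \<beta>) c)"
    by (auto simp: fun_eq_iff lin_comb_def mat_op_def sum_fun_apply sum_distrib_left sum_distrib_right mult_ac
        intro: sum.swap)
  finally show ?thesis .
qed

text \<open>Compares, on both sides of comultiplicativity for \<open>M \<alpha>\<close>, the
  coefficients of the tensor of \<open>M \<beta>\<close> and \<open>M \<gamma>\<close>.\<close>

lemma coef_append:
  assumes "\<alpha> \<in> compositions" "\<beta> \<in> compositions" "\<gamma> \<in> compositions"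
  shows "coef \<alpha> (\<beta> @ \<gamma>) = (\<Sum>(\<alpha>\<^sub>1, \<alpha>\<^sub>2)\<in>splits \<alpha>. coef \<alpha>\<^sub>1 \<beta> * coef \<alpha>\<^sub>2 \<gamma>)"
proof -
  let ?t = "coproduct (M \<alpha>)"
  have c: "M_coeff2 ?t (\<beta>', \<gamma>') = (if (\<beta>', \<gamma>') \<in> splits \<alpha> then 1 else 0)"
    if "\<beta>' \<in> compositions" "\<gamma>' \<in> compositions" for \<beta>' \<gamma>'
  proof -
    have "\<beta>' @ \<gamma>' \<in> compositions" using that by (auto simp: compositions_def)
    then show ?thesis
      using M_coeff2_eq[OF coproduct_M_in_span[OF assms(1)] that] coproduct_pack[OF M_in_QSym[OF assms(1)] that]
        M_pack[OF assms(1)] by (auto simp: splits_def)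
  qed
  have S: "{(\<beta>', \<gamma>'). \<beta>' \<in> compositions \<and> \<gamma>' \<in> compositions \<and> M_coeff2 ?t (\<beta>', \<gamma>') \<noteq> 0} = splits \<alpha>" (is "?S = _")
    using c splits_compositions[OF assms(1)] by (auto split: if_splits)
  have "coef \<alpha> (\<beta> @ \<gamma>) = coproduct (\<Phi> (M \<alpha>)) (pack \<beta>, pack \<gamma>)"
    using coproduct_pack[OF \<Phi>_in_QSym(2)[OF assms(1)] assms(2,3)] by (simp add: coef_def)
  also have "coproduct (\<Phi> (M \<alpha>)) = tensor_map \<Phi> ?t"
    using hopf M_in_QSym[OF assms(1)] by (auto simp: hopf_endo_def)
  also have "\<dots> (pack \<beta>, pack \<gamma>) = (\<Sum>(\<beta>', \<gamma>')\<in>splits \<alpha>. coef \<beta>' \<beta> * coef \<gamma>' \<gamma>)"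
    unfolding tensor_map_def S sum_fun_apply
  proof (rule sum.cong[OF refl])
    fix p assume p: "p \<in> splits \<alpha>"
    obtain \<beta>' \<gamma>' where bg: "p = (\<beta>', \<gamma>')" by (cases p)
    then show "(case p of (\<beta>', \<gamma>') \<Rightarrow> scale (M_coeff2 ?t (\<beta>', \<gamma>')) (tensor (\<Phi> (M \<beta>')) (\<Phi> (M \<gamma>')))) (pack \<beta>, pack \<gamma>) =
        (case p of (\<beta>', \<gamma>') \<Rightarrow> coef \<beta>' \<beta> * coef \<gamma>' \<gamma>)"
      using p splits_compositions[OF assms(1), of \<beta>' \<gamma>'] c[of \<beta>' \<gamma>'] by (simp add: tensor_def coef_def)
  qed
  finally show ?thesis .
qed

lemma coef_Nil: "coef [] [] = 1"
proof -
  have "\<Phi> ps_one = ps_one" using hopf by (simp add: hopf_endo_def)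
  then show ?thesis by (simp add: coef_def M_Nil ps_one_def pack_def xmono_def)
qed

lemma coef_one_part:
  assumes "\<beta> \<in> compositions" "coef \<beta> [a] \<noteq> 0" "a > 0"
  shows "\<beta> = [a] \<or> length \<beta> > 1"
proof -
  have "[a] \<in> compositions" using assms(3) by (auto simp: compositions_def)
  then have "\<beta> \<in> Comp a" using coef_zero[OF assms(1), of "[a]"] assms(1,2) by (auto simp: Comp_def)
  then show ?thesis using Comp_length_le_1[of \<beta> a] assms(3) by (auto simp: one_part_def not_less)
qed

text \<open>By \<open>coef_append\<close>, a nonzero entry splits \<beta> into one segment for each
  part of \<alpha>, of the same degree as that part. So \<beta> refines \<alpha>; of this only the
  effect on the length is recorded.\<close>

lemma coef_triangular:
  "\<alpha> \<in> compositions \<Longrightarrow> \<beta> \<in> compositions \<Longrightarrow> coef \<beta> \<alpha> \<noteq> 0 \<Longrightarrow> \<beta> = \<alpha> \<or> length \<beta> > length \<alpha>"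
proof (induction \<alpha> arbitrary: \<beta>)
  case Nil
  then show ?case by auto
next
  case (Cons a \<alpha>)
  have a: "a > 0" "[a] \<in> compositions" and \<alpha>: "\<alpha> \<in> compositions" using Cons.prems(1) by (auto simp: compositions_def)
  have "(\<Sum>(\<beta>\<^sub>1, \<beta>\<^sub>2)\<in>splits \<beta>. coef \<beta>\<^sub>1 [a] * coef \<beta>\<^sub>2 \<alpha>) \<noteq> 0"
    using coef_append[OF Cons.prems(2) a(2) \<alpha>] Cons.prems(3) by simp
  then obtain p where "p \<in> splits \<beta>" "(case p of (\<beta>\<^sub>1, \<beta>\<^sub>2) \<Rightarrow> coef \<beta>\<^sub>1 [a] * coef \<beta>\<^sub>2 \<alpha>) \<noteq> 0"
    by (rule sum.not_neutral_contains_not_neutral)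
  then obtain \<beta>\<^sub>1 \<beta>\<^sub>2 where sp: "(\<beta>\<^sub>1, \<beta>\<^sub>2) \<in> splits \<beta>" and nz: "coef \<beta>\<^sub>1 [a] \<noteq> 0" "coef \<beta>\<^sub>2 \<alpha> \<noteq> 0"
    by (cases p) auto
  have c: "\<beta>\<^sub>1 \<in> compositions" "\<beta>\<^sub>2 \<in> compositions" using splits_compositions[OF Cons.prems(2) sp] by auto
  show ?case
    using coef_one_part[OF c(1) nz(1) a(1)] Cons.IH[OF \<alpha> c(2) nz(2)] sp by (auto simp: splits_def)
qed

text \<open>For reasons of degree, only the split that cuts off exactly the first part
  contributes.\<close>

lemma coef_diag: "\<alpha> \<in> compositions \<Longrightarrow> coef \<alpha> \<alpha> = prod_list (map (\<lambda>a. coef [a] [a]) \<alpha>)"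
proof (induction \<alpha>)
  case (Cons a \<alpha>)
  have a: "a > 0" "[a] \<in> compositions" and \<alpha>: "\<alpha> \<in> compositions" using Cons.prems(1) by (auto simp: compositions_def)
  have "coef (a # \<alpha>) ([a] @ \<alpha>) = (\<Sum>(\<beta>, \<gamma>)\<in>splits (a # \<alpha>). coef \<beta> [a] * coef \<gamma> \<alpha>)"
    by (rule coef_append) fact+
  also have "\<dots> = coef [a] [a] * coef \<alpha> \<alpha>"
    by (rule sum_splits_Comp[OF Cons.prems]) (use coef_zero[OF _ a(2)] in \<open>auto simp: Comp_def\<close>)
  finally show ?case using Cons.IH[OF \<alpha>] by simp
qed (simp add: coef_Nil)

section \<open>The element (X^\<Phi>)_n and left multiplication by it\<close>

text \<open>Pairing with X at \<open>one_part n\<close> reads off the coefficient of M at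
  \<open>one_part n\<close>, which shows that this element qualifies. Testing against every
  \<open>M \<alpha>\<close> recovers all X coordinates, which gives the uniqueness that
  \<open>THE\<close> requires.\<close>

lemma X_of_eq: "X_of \<Phi> n = lin_comb (Comp n) (X n) (\<lambda>\<beta>. coef \<beta> (one_part n))"
proof -
  let ?P = "\<lambda>W. W \<in> descent_algebra n \<and>
     (\<forall>G\<in>QSym_deg n. pairing n W G = pairing n (X n (one_part n)) (\<Phi> G))"
  let ?W = "lin_comb (Comp n) (X n) (\<lambda>\<beta>. coef \<beta> (one_part n))"
  have one: "pairing n (X n (one_part n)) H = H (pack (one_part n))" if "H \<in> QSym_deg n" for H
  proof -
    have "pairing n (X n (one_part n)) H = dot (Comp n) (unitv (one_part n)) (\<lambda>\<alpha>. H (pack \<alpha>))"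
      by (subst X_as_lin_comb[OF one_part_in_Comp]) (simp add: pairing_lin_comb[OF that] dot_def)
    then show ?thesis by (simp add: dot_unitv(2)[OF finite_Comp one_part_in_Comp])
  qed
  have \<Phi>G: "\<Phi> G (pack (one_part n)) = (\<Sum>\<alpha>\<in>Comp n. coef \<alpha> (one_part n) * G (pack \<alpha>))" if "G \<in> QSym_deg n" for G
  proof -
    have "\<Phi> G = lin_comb (Comp n) (\<lambda>\<alpha>. \<Phi> (M \<alpha>)) (\<lambda>\<alpha>. G (pack \<alpha>))"
      by (subst QSym_deg_expand[OF that]) (rule \<Phi>_sum[OF finite_Comp], auto intro: M_in_QSym Comp_compositions)
    then show ?thesis by (simp add: lin_comb_def sum_fun_apply coef_def mult.commute)
  qed
  have "?P ?W"
  proof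
    show "?W \<in> descent_algebra n"
      unfolding descent_algebra_def lin_comb_def by (intro rvs.span_sum rvs.span_scale rvs.span_base imageI)
    show "\<forall>G\<in>QSym_deg n. pairing n ?W G = pairing n (X n (one_part n)) (\<Phi> G)"
      using one[OF \<Phi>_in_QSym_deg] \<Phi>G by (simp add: pairing_lin_comb)
  qed
  moreover have "W = ?W" if "?P W" for W
  proof -
    have "W \<in> lin_comb (Comp n) (X n) ` coords (Comp n)"
      using that by (simp add: descent_algebra_def lin_comb_image[OF finite_Comp])
    then obtain c where c: "W = lin_comb (Comp n) (X n) c" by auto
    have "c \<alpha> = coef \<alpha> (one_part n)" if \<alpha>: "\<alpha> \<in> Comp n" for \<alpha>
    proof -
      have "pairing n W (M \<alpha>) = X_coeff n W \<alpha>"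
      proof -
        have "pairing n W (M \<alpha>) = dot (Comp n) c (\<lambda>\<beta>. M \<alpha> (pack \<beta>))"
          unfolding c by (simp add: pairing_lin_comb[OF M_in_QSym_deg[OF \<alpha>]] dot_def)
        also have "\<dots> = dot (Comp n) c (unitv \<alpha>)"
          unfolding dot_def by (intro sum.cong) (auto simp: M_pack unitv_def Comp_compositions[of _ n] Comp_compositions[OF \<alpha>])
        also have "\<dots> = X_coeff n W \<alpha>"
          using \<alpha> by (simp add: dot_unitv finite_Comp c X_coeff_lin_comb)
        finally show ?thesis .
      qed
      then show ?thesis
        using \<open>?P W\<close> M_in_QSym_deg[OF \<alpha>] one[OF \<Phi>_in_QSym_deg[OF M_in_QSym_deg[OF \<alpha>]]] X_coeff_lin_comb[OF \<alpha>]
        by (simp add: c coef_def)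
    qed
    then show ?thesis unfolding c lin_comb_def by (intro sum.cong) auto
  qed
  ultimately show ?thesis unfolding X_of_def by (rule the_equality)
qed

lemma eig_eq: "eig \<Phi> m = coef (one_part m) (one_part m)"
proof -
  have "eig \<Phi> m = dot (Comp m) (\<lambda>\<beta>. coef \<beta> (one_part m)) (\<lambda>\<alpha>. M (one_part m) (pack \<alpha>))"
    unfolding eig_def X_of_eq
    by (simp add: pairing_lin_comb[OF M_in_QSym_deg[OF one_part_in_Comp]] dot_def)
  also have "\<dots> = dot (Comp m) (\<lambda>\<beta>. coef \<beta> (one_part m)) (unitv (one_part m))"
    unfolding dot_def
    by (intro sum.cong) (auto simp: M_pack unitv_def Comp_compositions[of _ m] Comp_compositions[OF one_part_in_Comp])
  finally show ?thesis by (simp add: dot_unitv finite_Comp one_part_in_Comp)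
qed

lemma eig_comp_eq: "\<alpha> \<in> compositions \<Longrightarrow> eig_comp \<Phi> \<alpha> = coef \<alpha> \<alpha>"
proof -
  assume \<alpha>: "\<alpha> \<in> compositions"
  then have "map (eig \<Phi>) \<alpha> = map (\<lambda>a. coef [a] [a]) \<alpha>"
    by (auto simp: eig_eq one_part_def compositions_def)
  then show ?thesis by (simp only: coef_diag[OF \<alpha>] eig_comp_def)
qed

text \<open>Applying \<Phi> and evaluating at (1,0,0,...) respects products, so the left side
  factors over the blocks of \<alpha>. Each factor is the image of a fundamental function, and
  \<open>coef_append\<close> merges the product of their sums into one sum over compositions of
  n.\<close>

lemma \<Phi>_labellings:
  assumes "length w = n" "\<alpha> \<in> Comp n"
  shows "\<Phi> (labellings w \<alpha>) (pack (one_part n)) = (\<Sum>\<beta>\<in>Comp n. if block_sorted (<) w \<beta> then coef \<beta> \<alpha> else 0)"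
proof -
  have one: "\<Phi> (labellings w (one_part n)) (pack (one_part n)) =
      (\<Sum>\<beta>\<in>Comp n. if block_sorted (<) w \<beta> then coef \<beta> (one_part n) else 0)" if "length w = n" for w n
  proof -
    have "\<Phi> (labellings w (one_part n)) = lin_comb (Comp n) (\<lambda>\<alpha>. \<Phi> (M \<alpha>)) (\<lambda>\<beta>. labellings w (one_part n) (pack \<beta>))"
      by (subst labellings_expand, unfold that) (rule \<Phi>_sum[OF finite_Comp], auto intro: M_in_QSym Comp_compositions)
    then show ?thesis
      using labellings_one_block[of _ w] that
      by (auto simp: lin_comb_def sum_fun_apply coef_def intro!: sum.cong)
  qed
  show ?thesis
    using assms
  proof (induction \<alpha> arbitrary: w n)
    case Nil
    \<comment> \<open>The empty composition is \<open>one_part 0\<close>, so the base case is an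
      instance of the formula for one block.\<close>
    then have "n = 0" and nil: "[] = one_part n" by (simp_all add: one_part_def)
    then show ?case unfolding nil using one[OF Nil.prems(1)] by simp
  next
    case (Cons a \<alpha>)
    have a: "a > 0" "a \<le> n" and \<alpha>: "\<alpha> \<in> Comp (n - a)" using Cons.prems(2) by (auto simp: Cons_in_Comp)
    have "[a] \<in> compositions" "one_part a = [a]" using a by (auto simp: compositions_def one_part_def)
    have la: "length (take a w) = a" "length (drop a w) = n - a" using a Cons.prems(1) by auto
    let ?f = "labellings (take a w) [a]" and ?g = "labellings (drop a w) \<alpha>"
    have fg: "?f \<in> QSym_deg a" "?g \<in> QSym_deg (n - a)"
      using labellings_in_QSym_deg[of "take a w" "[a]"] labellings_in_QSym_deg[of "drop a w" \<alpha>] la by auto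
    have mult: "\<Phi> (ps_mult ?f ?g) = ps_mult (\<Phi> ?f) (\<Phi> ?g)"
      using hopf fg QSym_deg_subset unfolding hopf_endo_def by blast
    have "\<Phi> (labellings w (a # \<alpha>)) (pack (one_part n)) = ps_mult (\<Phi> ?f) (\<Phi> ?g) (pack (one_part (a + (n - a))))"
      using labellings_Cons[of a w \<alpha>] a Cons.prems(1) mult by simp
    also have "\<dots> = \<Phi> ?f (pack (one_part a)) * \<Phi> ?g (pack (one_part (n - a)))"
      by (rule ps_mult_one_part) (intro \<Phi>_in_QSym_deg fg)+
    also have "\<dots> = (\<Sum>\<beta>\<in>Comp a. if block_sorted (<) (take a w) \<beta> then coef \<beta> [a] else 0) *
        (\<Sum>\<gamma>\<in>Comp (n - a). if block_sorted (<) (drop a w) \<gamma> then coef \<gamma> \<alpha> else 0)"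
      using one[OF la(1), unfolded \<open>one_part a = [a]\<close>] Cons.IH[OF la(2) \<alpha>] \<open>one_part a = [a]\<close> by simp
    also have "\<dots> = (\<Sum>\<beta>\<in>Comp a. \<Sum>\<gamma>\<in>Comp (n - a). if block_sorted (<) w (\<beta> @ \<gamma>) then coef \<beta> [a] * coef \<gamma> \<alpha> else 0)"
      unfolding sum_product
    proof (intro sum.cong refl)
      fix \<beta> \<gamma> assume "\<beta> \<in> Comp a"
      then show "(if block_sorted (<) (take a w) \<beta> then coef \<beta> [a] else 0) * (if block_sorted (<) (drop a w) \<gamma> then coef \<gamma> \<alpha> else 0) =
          (if block_sorted (<) w (\<beta> @ \<gamma>) then coef \<beta> [a] * coef \<gamma> \<alpha> else 0)"
        using block_sorted_append[of \<beta> a "(<)" w \<gamma>] by (simp add: Comp_def)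
    qed
    \<comment> \<open>Entries of \<open>coef\<close> between different degrees vanish, so splits of
      \<beta> at other places may be added freely.\<close>
    also have "\<dots> = (\<Sum>\<beta>\<in>Comp (a + (n - a)). \<Sum>(\<beta>\<^sub>1, \<beta>\<^sub>2)\<in>splits \<beta>.
        if block_sorted (<) w (\<beta>\<^sub>1 @ \<beta>\<^sub>2) then coef \<beta>\<^sub>1 [a] * coef \<beta>\<^sub>2 \<alpha> else 0)"
      by (rule sum_splits[symmetric]) (use coef_zero[OF _ \<open>[a] \<in> compositions\<close>] in \<open>auto simp: Comp_def\<close>)
    also have "\<dots> = (\<Sum>\<beta>\<in>Comp n. if block_sorted (<) w \<beta> then coef \<beta> (a # \<alpha>) else 0)"
    proof (rule sum.cong)
      show "Comp (a + (n - a)) = Comp n" using a by simp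
      fix \<beta> assume "\<beta> \<in> Comp n"
      then have "coef \<beta> ([a] @ \<alpha>) = (\<Sum>(\<beta>\<^sub>1, \<beta>\<^sub>2)\<in>splits \<beta>. coef \<beta>\<^sub>1 [a] * coef \<beta>\<^sub>2 \<alpha>)"
        using \<alpha> \<open>[a] \<in> compositions\<close> by (intro coef_append) (auto simp: Comp_def)
      moreover have "(\<Sum>(\<beta>\<^sub>1, \<beta>\<^sub>2)\<in>splits \<beta>. if block_sorted (<) w (\<beta>\<^sub>1 @ \<beta>\<^sub>2) then coef \<beta>\<^sub>1 [a] * coef \<beta>\<^sub>2 \<alpha> else 0) =
          (\<Sum>(\<beta>\<^sub>1, \<beta>\<^sub>2)\<in>splits \<beta>. if block_sorted (<) w \<beta> then coef \<beta>\<^sub>1 [a] * coef \<beta>\<^sub>2 \<alpha> else 0)"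
        by (rule sum.cong) (auto simp: splits_def)
      ultimately show "(\<Sum>(\<beta>\<^sub>1, \<beta>\<^sub>2)\<in>splits \<beta>. if block_sorted (<) w (\<beta>\<^sub>1 @ \<beta>\<^sub>2) then coef \<beta>\<^sub>1 [a] * coef \<beta>\<^sub>2 \<alpha> else 0) =
          (if block_sorted (<) w \<beta> then coef \<beta> (a # \<alpha>) else 0)" by simp
    qed
    finally show ?case .
  qed
qed

text \<open>By \<open>X_mult_X\<close> the product with \<open>X n \<alpha>\<close>, at \<rho>, is a
  sum of M coefficients of a labelling series weighted by \<open>coef\<close> at
  \<open>one_part n\<close>. That sum is \<Phi> of the series evaluated at (1,0,0,...), and
  \<open>\<Phi>_labellings\<close> returns it as a combination of the values
  \<open>X n \<beta> \<rho>\<close>.\<close>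

lemma X_of_mult:
  "galg_mult n (X_of \<Phi> n) (lin_comb (Comp n) (X n) c) =
    lin_comb (Comp n) (X n) (mat_op (Comp n) coef c)"
proof
  fix \<rho>
  let ?P = "{(\<sigma>, \<tau>). \<sigma> permutes {1..n} \<and> \<tau> permutes {1..n} \<and> \<sigma> \<circ> \<tau> = \<rho>}"
  show "galg_mult n (X_of \<Phi> n) (lin_comb (Comp n) (X n) c) \<rho> =
    lin_comb (Comp n) (X n) (mat_op (Comp n) coef c) \<rho>"
  proof (cases "\<rho> permutes {1..n}")
    case False
    then have empty: "?P = {}" using permutes_compose by blast
    have "galg_mult n (X_of \<Phi> n) (lin_comb (Comp n) (X n) c) \<rho> = 0"
      unfolding galg_mult_def empty by simp
    moreover have "lin_comb (Comp n) (X n) (mat_op (Comp n) coef c) \<rho> = 0"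
      unfolding lin_comb_def sum_fun_apply by (rule sum.neutral) (use False in \<open>auto simp: X_def\<close>)
    ultimately show ?thesis by simp
  next
    case True
    let ?x = "\<lambda>\<beta>. coef \<beta> (one_part n)"
    have "galg_mult n (X_of \<Phi> n) (lin_comb (Comp n) (X n) c) \<rho> =
        (\<Sum>p\<in>?P. \<Sum>\<alpha>\<in>Comp n. \<Sum>\<beta>\<in>Comp n. c \<alpha> * (?x \<beta> * (X n \<beta> (fst p) * X n \<alpha> (snd p))))"
      unfolding galg_mult_def X_of_eq lin_comb_def sum_fun_apply scale_apply case_prod_beta sum_product
      by (rule sum.cong[OF refl], subst sum.swap) (simp add: mult_ac)
    also have "\<dots> = (\<Sum>\<alpha>\<in>Comp n. \<Sum>\<beta>\<in>Comp n. \<Sum>p\<in>?P. c \<alpha> * (?x \<beta> * (X n \<beta> (fst p) * X n \<alpha> (snd p))))"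
      by (subst sum.swap, intro sum.cong refl, rule sum.swap)
    also have "\<dots> = (\<Sum>\<alpha>\<in>Comp n. c \<alpha> * (\<Sum>\<beta>\<in>Comp n. ?x \<beta> * galg_mult n (X n \<beta>) (X n \<alpha>) \<rho>))"
      by (simp add: galg_mult_def sum_distrib_left case_prod_beta)
    also have "\<dots> = (\<Sum>\<alpha>\<in>Comp n. c \<alpha> * \<Phi> (labellings (word n \<rho>) \<alpha>) (pack (one_part n)))"
    proof (intro sum.cong refl arg_cong2[where f = "(*)"])
      fix \<alpha> assume \<alpha>: "\<alpha> \<in> Comp n"
      have "\<Phi> (labellings (word n \<rho>) \<alpha>) = lin_comb (Comp n) (\<lambda>\<beta>. \<Phi> (M \<beta>)) (\<lambda>\<beta>. labellings (word n \<rho>) \<alpha> (pack \<beta>))"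
        by (subst labellings_expand, unfold length_word)
           (rule \<Phi>_sum[OF finite_Comp], auto intro: M_in_QSym Comp_compositions)
      then have "\<Phi> (labellings (word n \<rho>) \<alpha>) (pack (one_part n)) = (\<Sum>\<beta>\<in>Comp n. labellings (word n \<rho>) \<alpha> (pack \<beta>) * ?x \<beta>)"
        by (simp add: lin_comb_def sum_fun_apply coef_def)
      then show "(\<Sum>\<beta>\<in>Comp n. ?x \<beta> * galg_mult n (X n \<beta>) (X n \<alpha>) \<rho>) = \<Phi> (labellings (word n \<rho>) \<alpha>) (pack (one_part n))"
        using X_mult_X[OF \<alpha> _ True] by (simp add: mult.commute)
    qed
    also have "\<dots> = (\<Sum>\<alpha>\<in>Comp n. c \<alpha> * (\<Sum>\<beta>\<in>Comp n. coef \<beta> \<alpha> * X n \<beta> \<rho>))"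
      using True by (intro sum.cong refl arg_cong2[where f = "(*)"]) (auto simp: \<Phi>_labellings X_eq intro!: sum.cong)
    also have "\<dots> = (\<Sum>\<beta>\<in>Comp n. (\<Sum>\<alpha>\<in>Comp n. coef \<beta> \<alpha> * c \<alpha>) * X n \<beta> \<rho>)"
      unfolding sum_distrib_left sum_distrib_right by (subst sum.swap) (simp add: mult_ac)
    also have "\<dots> = lin_comb (Comp n) (X n) (mat_op (Comp n) coef c) \<rho>"
      by (simp add: lin_comb_def sum_fun_apply mat_op_def)
    finally show ?thesis .
  qed
qed

section \<open>Eigenvectors of the transposed matrix\<close>

text \<open>Since \<open>coef\<close> is triangular with diagonal \<open>eig_comp \<Phi>\<close>, the eigenvector equation
  can be solved coordinate by coordinate in order of increasing length.\<close>

lemma one_part_eigenvector: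
  assumes sep: "\<And>\<beta>. \<beta> \<in> Comp m - {one_part m} \<Longrightarrow> eig \<Phi> m \<noteq> eig_comp \<Phi> \<beta>"
  obtains v where "v \<in> coords (Comp m)" "v (one_part m) = 1"
    "mat_op (Comp m) coef v = scale (eig \<Phi> m) v"
proof -
  define R where "R = inv_image less_than (length :: nat list \<Rightarrow> nat)"
  \<comment> \<open>Row \<beta> of the equation, solved for \<open>v \<beta>\<close>: only shorter
    \<gamma> contribute off the diagonal, and separation makes the denominator nonzero. The leading
    entry is normalised to 1.\<close>
  define F where "F v \<beta> = (if \<beta> = one_part m then 1 else if \<beta> \<in> Comp m
    then (\<Sum>\<gamma>\<in>{\<gamma>\<in>Comp m. length \<gamma> < length \<beta>}. coef \<beta> \<gamma> * v \<gamma>) / (eig \<Phi> m - eig_comp \<Phi> \<beta>) else 0)"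
    for v :: "nat list \<Rightarrow> rat" and \<beta>
  define v where "v = wfrec R F"
  have "adm_wf R F"
    by (auto simp: adm_wf_def F_def R_def intro!: sum.cong)
  moreover have "wf R" by (simp add: R_def wf_inv_image)
  ultimately have v: "v = F v" unfolding v_def by (intro ext wfrec_fixpoint)
  have one: "v (one_part m) = 1" by (subst v) (simp add: F_def)
  have supp: "v \<in> coords (Comp m)"
  proof -
    have "v \<beta> = 0" if "\<beta> \<notin> Comp m" for \<beta>
      by (subst v) (use that one_part_in_Comp in \<open>auto simp: F_def\<close>)
    then show ?thesis by (simp add: coords_def)
  qed
  have "mat_op (Comp m) coef v \<beta> = eig \<Phi> m * v \<beta>" if \<beta>: "\<beta> \<in> Comp m" for \<beta>
  proof -
    let ?S = "{\<gamma>\<in>Comp m. length \<gamma> < length \<beta>}"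
    have "(\<Sum>\<gamma>\<in>Comp m. coef \<beta> \<gamma> * v \<gamma>) = (\<Sum>\<gamma>\<in>insert \<beta> ?S. coef \<beta> \<gamma> * v \<gamma>)"
    proof (rule sum.mono_neutral_right[OF finite_Comp])
      show "\<forall>\<gamma>\<in>Comp m - insert \<beta> ?S. coef \<beta> \<gamma> * v \<gamma> = 0"
        using coef_triangular[OF Comp_compositions Comp_compositions[OF \<beta>]] by fastforce
    qed (use \<beta> in auto)
    also have "\<dots> = coef \<beta> \<beta> * v \<beta> + (\<Sum>\<gamma>\<in>?S. coef \<beta> \<gamma> * v \<gamma>)"
      by (rule sum.insert) (auto simp: finite_Comp)
    also have "\<dots> = eig \<Phi> m * v \<beta>"
    proof (cases "\<beta> = one_part m")
      case True
      \<comment> \<open>Nothing is shorter than \<open>one_part m\<close>, so its row reduces to the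
        diagonal entry, which is the eigenvalue itself.\<close>
      have False if "\<gamma> \<in> ?S" for \<gamma> using Comp_length_le_1[of \<gamma> m] that True by auto
      then have S: "?S = {}" by blast
      show ?thesis unfolding S using True eig_eq by simp
    next
      case False
      have "eig \<Phi> m - eig_comp \<Phi> \<beta> \<noteq> 0" using sep \<beta> False by auto
      moreover have "v \<beta> = (\<Sum>\<gamma>\<in>?S. coef \<beta> \<gamma> * v \<gamma>) / (eig \<Phi> m - eig_comp \<Phi> \<beta>)"
        by (subst v) (use \<beta> False in \<open>simp add: F_def\<close>)
      ultimately show ?thesis using eig_comp_eq[OF Comp_compositions[OF \<beta>]] by (simp add: field_simps)
    qed
    finally show ?thesis using \<beta> by (simp add: mat_op_def)
  qed
  moreover have "mat_op (Comp m) coef v \<beta> = eig \<Phi> m * v \<beta>" if "\<beta> \<notin> Comp m" for \<beta>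
    using supp that by (simp add: coords_def mat_op_def)
  ultimately have "mat_op (Comp m) coef v = scale (eig \<Phi> m) v" by (metis ext scale_apply)
  with that supp one show ?thesis by blast
qed

text \<open>The transposed matrix acts as an algebra endomorphism for the concatenation product, so
  concatenating eigenvectors gives eigenvectors.\<close>

definition concat_prod :: "(nat list \<Rightarrow> rat) \<Rightarrow> (nat list \<Rightarrow> rat) \<Rightarrow> nat list \<Rightarrow> rat" where
  "concat_prod f g \<alpha> = (\<Sum>(\<beta>, \<gamma>)\<in>splits \<alpha>. f \<beta> * g \<gamma>)"

lemma concat_prod_nonzero:
  assumes "concat_prod f g \<alpha> \<noteq> 0"
  obtains \<beta> \<gamma> where "\<alpha> = \<beta> @ \<gamma>" "f \<beta> \<noteq> 0" "g \<gamma> \<noteq> 0"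
proof -
  obtain p where "p \<in> splits \<alpha>" "(case p of (\<beta>, \<gamma>) \<Rightarrow> f \<beta> * g \<gamma>) \<noteq> 0"
    using assms unfolding concat_prod_def by (rule sum.not_neutral_contains_not_neutral)
  then show ?thesis using that by (cases p) (auto simp: splits_def)
qed

lemma concat_prod_in_coords:
  assumes "f \<in> coords (Comp a)" "g \<in> coords (Comp b)"
  shows "concat_prod f g \<in> coords (Comp (a + b))"
proof -
  have "\<alpha> \<in> Comp (a + b)" if nz: "concat_prod f g \<alpha> \<noteq> 0" for \<alpha>
  proof -
    obtain \<beta> \<gamma> where "\<alpha> = \<beta> @ \<gamma>" "f \<beta> \<noteq> 0" "g \<gamma> \<noteq> 0" using concat_prod_nonzero[OF nz] .
    then show ?thesis using assms append_in_Comp[of \<beta> a \<gamma> b] by (auto simp: coords_def)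
  qed
  then show ?thesis by (auto simp: coords_def)
qed

text \<open>This is comultiplicativity of \<Phi> seen from the transposed side: after
  \<open>coef_append\<close> the sums over the two column indices separate for each split of
  \<beta>.\<close>

lemma mat_op_concat_prod:
  assumes f: "f \<in> coords (Comp a)" and g: "g \<in> coords (Comp b)"
  shows "mat_op (Comp (a + b)) coef (concat_prod f g) =
    concat_prod (mat_op (Comp a) coef f) (mat_op (Comp b) coef g)"
proof
  fix \<beta>
  show "mat_op (Comp (a + b)) coef (concat_prod f g) \<beta> =
    concat_prod (mat_op (Comp a) coef f) (mat_op (Comp b) coef g) \<beta>"
  proof (cases "\<beta> \<in> Comp (a + b)")
    case False
    then show ?thesis
      using mat_op_in_coords[of "Comp (a + b)" coef] concat_prod_in_coords[OF mat_op_in_coords mat_op_in_coords]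
      by (auto simp: coords_def)
  next
    case True
    have \<beta>: "\<beta> \<in> compositions" using True by (rule Comp_compositions)
    have "mat_op (Comp (a + b)) coef (concat_prod f g) \<beta> =
        (\<Sum>\<gamma>\<in>Comp (a + b). \<Sum>(\<gamma>\<^sub>1, \<gamma>\<^sub>2)\<in>splits \<gamma>. coef \<beta> (\<gamma>\<^sub>1 @ \<gamma>\<^sub>2) * (f \<gamma>\<^sub>1 * g \<gamma>\<^sub>2))"
      using True unfolding mat_op_def concat_prod_def
      by (auto simp: sum_distrib_left splits_def intro!: sum.cong)
    also have "\<dots> = (\<Sum>\<gamma>\<^sub>1\<in>Comp a. \<Sum>\<gamma>\<^sub>2\<in>Comp b. coef \<beta> (\<gamma>\<^sub>1 @ \<gamma>\<^sub>2) * (f \<gamma>\<^sub>1 * g \<gamma>\<^sub>2))"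
      by (rule sum_splits) (use f in \<open>auto simp: coords_def\<close>)
    also have "\<dots> = (\<Sum>\<gamma>\<^sub>1\<in>Comp a. \<Sum>\<gamma>\<^sub>2\<in>Comp b. \<Sum>p\<in>splits \<beta>. (coef (fst p) \<gamma>\<^sub>1 * f \<gamma>\<^sub>1) * (coef (snd p) \<gamma>\<^sub>2 * g \<gamma>\<^sub>2))"
      using coef_append[OF \<beta>] Comp_compositions
      by (intro sum.cong refl) (auto simp: sum_distrib_left sum_distrib_right case_prod_beta mult_ac)
    also have "\<dots> = (\<Sum>p\<in>splits \<beta>. \<Sum>\<gamma>\<^sub>1\<in>Comp a. \<Sum>\<gamma>\<^sub>2\<in>Comp b. (coef (fst p) \<gamma>\<^sub>1 * f \<gamma>\<^sub>1) * (coef (snd p) \<gamma>\<^sub>2 * g \<gamma>\<^sub>2))"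
      unfolding sum.swap[where A = "splits \<beta>"] ..
    also have "\<dots> = concat_prod (mat_op (Comp a) coef f) (mat_op (Comp b) coef g) \<beta>"
      unfolding concat_prod_def
    proof (rule sum.cong[OF refl])
      fix p assume p: "p \<in> splits \<beta>"
      obtain \<beta>\<^sub>1 \<beta>\<^sub>2 where bp: "p = (\<beta>\<^sub>1, \<beta>\<^sub>2)" by (cases p)
      have c: "\<beta>\<^sub>1 \<in> compositions" "\<beta>\<^sub>2 \<in> compositions" "\<beta> = \<beta>\<^sub>1 @ \<beta>\<^sub>2"
        using splits_compositions[OF \<beta>] p bp by (auto simp: splits_def)
      show "(\<Sum>\<gamma>\<^sub>1\<in>Comp a. \<Sum>\<gamma>\<^sub>2\<in>Comp b. (coef (fst p) \<gamma>\<^sub>1 * f \<gamma>\<^sub>1) * (coef (snd p) \<gamma>\<^sub>2 * g \<gamma>\<^sub>2)) =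
          (case p of (\<beta>\<^sub>1, \<beta>\<^sub>2) \<Rightarrow> mat_op (Comp a) coef f \<beta>\<^sub>1 * mat_op (Comp b) coef g \<beta>\<^sub>2)"
      proof (cases "\<beta>\<^sub>1 \<in> Comp a")
        case True
        then have "\<beta>\<^sub>2 \<in> Comp b" using \<open>\<beta> \<in> Comp (a + b)\<close> c by (auto simp: Comp_def)
        then show ?thesis using True bp by (simp add: mat_op_def sum_product)
      next
        \<comment> \<open>For a split in the wrong degrees the left side vanishes because
          \<open>coef\<close> preserves degree, the right side because \<open>mat_op\<close> is 0
          outside its index set.\<close>
        case False
        then have "coef \<beta>\<^sub>1 \<gamma> = 0" if "\<gamma> \<in> Comp a" for \<gamma>
          using coef_zero[OF c(1), of \<gamma>] c(1) that by (auto simp: Comp_def)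
        then show ?thesis using False bp by (simp add: mat_op_def)
      qed
    qed
    finally show ?thesis .
  qed
qed

text \<open>Concatenates the eigenvectors belonging to the single parts. Eigenvalues multiply, and
  since lengths add, \<alpha> is the unique shortest term; this leading term is kept in the
  conclusion because independence relies on it.\<close>

lemma composition_eigenvector:
  assumes "\<alpha> \<in> Comp n"
    and "\<And>a \<beta>. a \<in> set \<alpha> \<Longrightarrow> \<beta> \<in> Comp a - {one_part a} \<Longrightarrow> eig \<Phi> a \<noteq> eig_comp \<Phi> \<beta>"
  shows "\<exists>v\<in>coords (Comp n). v \<alpha> = 1 \<and> (\<forall>\<beta>. v \<beta> \<noteq> 0 \<longrightarrow> \<beta> = \<alpha> \<or> length \<beta> > length \<alpha>) \<and>
    mat_op (Comp n) coef v = scale (eig_comp \<Phi> \<alpha>) v"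
  using assms
proof (induction \<alpha> arbitrary: n)
  case Nil
  have "mat_op (Comp 0) coef (unitv []) = unitv []"
    by (auto simp: fun_eq_iff mat_op_def unitv_def Comp_0 coef_Nil)
  then show ?case using Nil
    by (intro bexI[of _ "unitv []"]) (auto simp: unitv_def coords_def eig_comp_def fun_eq_iff)
next
  case (Cons a \<alpha>)
  have a: "a > 0" "a \<le> n" and \<alpha>: "\<alpha> \<in> Comp (n - a)" using Cons.prems(1) by (auto simp: Cons_in_Comp)
  have one: "one_part a = [a]" using a by (simp add: one_part_def)
  obtain u where u: "u \<in> coords (Comp a)" "u [a] = 1" "mat_op (Comp a) coef u = scale (eig \<Phi> a) u"
    using one_part_eigenvector[of a] Cons.prems(2)[of a] one by auto
  have "\<exists>v\<in>coords (Comp (n - a)). v \<alpha> = 1 \<and> (\<forall>\<beta>. v \<beta> \<noteq> 0 \<longrightarrow> \<beta> = \<alpha> \<or> length \<beta> > length \<alpha>) \<and>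
    mat_op (Comp (n - a)) coef v = scale (eig_comp \<Phi> \<alpha>) v"
    by (rule Cons.IH[OF \<alpha>]) (rule Cons.prems(2), auto)
  then obtain v where v: "v \<in> coords (Comp (n - a))" "v \<alpha> = 1" "\<And>\<beta>. v \<beta> \<noteq> 0 \<Longrightarrow> \<beta> = \<alpha> \<or> length \<beta> > length \<alpha>"
    "mat_op (Comp (n - a)) coef v = scale (eig_comp \<Phi> \<alpha>) v"
    by blast
  let ?w = "concat_prod u v"
  have "?w \<in> coords (Comp n)" using concat_prod_in_coords[OF u(1) v(1)] a by simp
  moreover have "?w (a # \<alpha>) = 1"
    unfolding concat_prod_def
    using sum_splits_Comp[of a \<alpha> "\<lambda>\<beta> \<gamma>. u \<beta> * v \<gamma>"] Comp_compositions[OF Cons.prems(1)] u(1,2) v(2)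
    by (simp add: coords_def)
  moreover have "\<beta> = a # \<alpha> \<or> length \<beta> > length (a # \<alpha>)" if nz: "?w \<beta> \<noteq> 0" for \<beta>
  proof -
    obtain \<beta>\<^sub>1 \<beta>\<^sub>2 where b: "\<beta> = \<beta>\<^sub>1 @ \<beta>\<^sub>2" "u \<beta>\<^sub>1 \<noteq> 0" "v \<beta>\<^sub>2 \<noteq> 0" using concat_prod_nonzero[OF nz] .
    have "\<beta>\<^sub>1 \<in> Comp a" using u(1) b(2) by (auto simp: coords_def)
    then have "\<beta>\<^sub>1 = [a] \<or> length \<beta>\<^sub>1 > 1" using Comp_length_le_1[of \<beta>\<^sub>1 a] by (auto simp: one not_less)
    then show ?thesis using v(3)[OF b(3)] b(1) by auto
  qed
  moreover have "mat_op (Comp n) coef ?w = scale (eig_comp \<Phi> (a # \<alpha>)) ?w"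
  proof -
    have "mat_op (Comp n) coef ?w = concat_prod (scale (eig \<Phi> a) u) (scale (eig_comp \<Phi> \<alpha>) v)"
      using mat_op_concat_prod[OF u(1) v(1)] a u(3) v(4) by simp
    also have "\<dots> = scale (eig_comp \<Phi> (a # \<alpha>)) ?w"
      by (auto simp: fun_eq_iff concat_prod_def eig_comp_def sum_distrib_left mult_ac intro!: sum.cong)
    finally show ?thesis .
  qed
  ultimately show ?case by blast
qed

lemma diagonalizable_coef:
  assumes sep: "\<And>m \<beta>. m \<le> n \<Longrightarrow> eig \<Phi> m \<noteq> 0 \<Longrightarrow> \<beta> \<in> Comp m - {one_part m} \<Longrightarrow> eig \<Phi> m \<noteq> eig_comp \<Phi> \<beta>"
    and rank: "rvs.dim (\<Phi> ` QSym_deg n) = card {\<alpha> \<in> Comp n. eig_comp \<Phi> \<alpha> \<noteq> 0}"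
  shows "diagonalizable_on (coords (Comp n)) (mat_op (Comp n) coef)"
proof -
  let ?J = "{\<alpha> \<in> Comp n. eig_comp \<Phi> \<alpha> \<noteq> 0}"
  have "\<exists>v\<in>coords (Comp n). v \<alpha> = 1 \<and> (\<forall>\<beta>. v \<beta> \<noteq> 0 \<longrightarrow> \<beta> = \<alpha> \<or> length \<beta> > length \<alpha>) \<and>
      mat_op (Comp n) coef v = scale (eig_comp \<Phi> \<alpha>) v" if \<alpha>: "\<alpha> \<in> ?J" for \<alpha>
  proof (rule composition_eigenvector)
    show "\<alpha> \<in> Comp n" using \<alpha> by simp
    fix a \<beta> assume a: "a \<in> set \<alpha>" "\<beta> \<in> Comp a - {one_part a}"
    have "a \<le> n" using member_le_sum_list[OF a(1)] \<alpha> by (simp add: Comp_def)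
    \<comment> \<open>A nonzero product has nonzero factors, so the separation hypothesis is
      available for each part of \<alpha>.\<close>
    moreover have "eig \<Phi> a \<noteq> 0" using \<alpha> a(1) by (force simp: eig_comp_def prod_list_zero_iff)
    ultimately show "eig \<Phi> a \<noteq> eig_comp \<Phi> \<beta>" using sep a(2) by blast
  qed
  then have "\<forall>\<alpha>\<in>?J. \<exists>v. v \<in> coords (Comp n) \<and> v \<alpha> = 1 \<and> (\<forall>\<beta>. v \<beta> \<noteq> 0 \<longrightarrow> \<beta> = \<alpha> \<or> length \<beta> > length \<alpha>) \<and>
      mat_op (Comp n) coef v = scale (eig_comp \<Phi> \<alpha>) v" by blast
  from bchoice[OF this] obtain e where
    e': "\<forall>\<alpha>\<in>?J. e \<alpha> \<in> coords (Comp n) \<and> e \<alpha> \<alpha> = 1 \<and>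
      (\<forall>\<beta>. e \<alpha> \<beta> \<noteq> 0 \<longrightarrow> \<beta> = \<alpha> \<or> length \<beta> > length \<alpha>) \<and>
      mat_op (Comp n) coef (e \<alpha>) = scale (eig_comp \<Phi> \<alpha>) (e \<alpha>)" ..
  have e: "e \<alpha> \<in> coords (Comp n)" "e \<alpha> \<alpha> = 1" "e \<alpha> \<beta> \<noteq> 0 \<Longrightarrow> \<beta> = \<alpha> \<or> length \<beta> > length \<alpha>"
    "mat_op (Comp n) coef (e \<alpha>) = scale (eig_comp \<Phi> \<alpha>) (e \<alpha>)" if "\<alpha> \<in> ?J" for \<alpha> \<beta>
    using e' that by blast+
  have diag: "e \<alpha> \<alpha> \<noteq> 0" if "\<alpha> \<in> ?J" for \<alpha> using e(2)[OF that] by simp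
  \<comment> \<open>The vector \<open>e \<beta>\<close> lives on \<beta> and longer compositions, so
    the negated length is the rank that singles out leading terms.\<close>
  have tri: "- int (length \<alpha>) < - int (length \<beta>)" if "\<alpha> \<in> ?J" "\<beta> \<in> ?J" "\<alpha> \<noteq> \<beta>" "e \<beta> \<alpha> \<noteq> 0" for \<alpha> \<beta>
    using e(3)[OF that(2,4)] that(3) by simp
  have ind: "inj_on e ?J" "rvs.independent (e ` ?J)"
    by (rule triangular_independent(1)[where p = "\<lambda>\<alpha>. \<alpha>" and r = "\<lambda>\<alpha>. - int (length \<alpha>)"], fact diag, fact tri)
       (rule triangular_independent(2)[where p = "\<lambda>\<alpha>. \<alpha>" and r = "\<lambda>\<alpha>. - int (length \<alpha>)"], fact diag, fact tri)
  \<comment> \<open>The rank hypothesis concerns \<Phi>, whose matrix is the transpose of the one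
    being diagonalized; this is the form required for producing the kernel.\<close>
  have rank': "rvs.dim (mat_op (Comp n) (\<lambda>\<beta> \<alpha>. coef \<alpha> \<beta>) ` coords (Comp n)) = card ?J"
    using dim_transport[OF finite_Comp M_basis_deg \<Phi>_matrix] rank by (simp add: QSym_deg_def)
  show ?thesis
    by (rule eigenvectors_rank_diagonalizable[where J = ?J and e = e and ev = "eig_comp \<Phi>"])
       (use finite_Comp ind rank' e(1,4) in auto)
qed

end

theorem theorem4p3:
  fixes \<Phi> :: "pseries \<Rightarrow> pseries" and n :: nat
  assumes "hopf_endo \<Phi>"
    and "\<And>m \<beta>. m \<le> n \<Longrightarrow> eig \<Phi> m \<noteq> 0 \<Longrightarrow> \<beta> \<in> Comp m - {one_part m} \<Longrightarrow>
           eig \<Phi> m \<noteq> eig_comp \<Phi> \<beta>"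
    and "rvs.dim (\<Phi> ` QSym_deg n) = card {\<alpha> \<in> Comp n. eig_comp \<Phi> \<alpha> \<noteq> 0}"
  shows "diagonalizable_on (QSym_deg n) \<Phi> \<and>
         diagonalizable_on (descent_algebra n) (\<lambda>W. galg_mult n (X_of \<Phi> n) W)"
proof
  have diag: "diagonalizable_on (coords (Comp n)) (mat_op (Comp n) (coef \<Phi>))"
    by (rule diagonalizable_coef) fact+
  \<comment> \<open>The basis M needs the transposed matrix, hence the passage through the dual
    basis; the basis X uses \<open>coef\<close> directly.\<close>
  show "diagonalizable_on (QSym_deg n) \<Phi>"
    unfolding QSym_deg_def
    by (rule diagonalizable_transport[OF finite_Comp M_basis_deg])
       (rule \<Phi>_matrix[OF assms(1)], rule diagonalizable_transpose[OF finite_Comp diag])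
  show "diagonalizable_on (descent_algebra n) (\<lambda>W. galg_mult n (X_of \<Phi> n) W)"
    unfolding descent_algebra_def
    by (rule diagonalizable_transport[OF finite_Comp X_basis])
       (rule X_of_mult[OF assms(1)], rule diag)
qed

end
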